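(* Let $n$ be a positive odd integer, let $a,b,c$ be indeterminates, and let $M$ be either $n-1$ or $(n-1)/2$. Then, modulo $[n](1-aq^n)(a-q^n)$, \[ \sum_{k=0}^{M}[3k+1]\frac{(aq,q/a,q;q^2)_k\, (q/b,q/c,bc;q)_k} {(aq,q/a,q;q)_k\, (bq^2,cq^2,q^3/bc;q^2)_k}\, q^k \equiv\frac{(bcq,q^2/b,q^2/c;q^2)_{(n-1)/2}} {(q^3/bc,bq^2,cq^2;q^2)_{(n-1)/2}}\,[n]. \]
   Context: Here $q,a,b,c$ are indeterminates. For $x$ and a base $p$ (a power of $q$), $(x;p)_k=\prod_{j=0}^{k-1}(1-xp^j)$ and $(x_1,\dots,x_m;p)_k=(x_1;p)_k\cdots(x_m;p)_k$. The $q$-integer is $[j]=1+q+\cdots+q^{j-1}$. For rational functions $A,B$ in $q,a,b,c$ and a polynomial $P$, $A\equiv B\pmod{P}$ means that the numerator of the reduced form of $A-B$ is divisible by $P$ in the polynomial ring over $\mathbb{Z}$ in these variables. *)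

theory Defs
  imports "HOL-Computational_Algebra.Computational_Algebra"
begin

text \<open>
  The polynomial ring over the integers in the four indeterminates \<open>q, a, b, c\<close> is the
  iterated univariate polynomial ring \<open>\<int>[q][a][b][c]\<close>, with \<open>q\<close> innermost. Its fraction field
  is the field of rational functions in these indeterminates.
\<close>

type_synonym zpoly = "int poly poly poly poly"

definition indet_q :: zpoly where "indet_q = [:[:[:[:0, 1:]:]:]:]"
definition indet_a :: zpoly where "indet_a = [:[:[:0, 1:]:]:]"
definition indet_b :: zpoly where "indet_b = [:[:0, 1:]:]"
definition indet_c :: zpoly where "indet_c = [:0, 1:]"

definition qpochhammer :: "'a::comm_ring_1 \<Rightarrow> 'a \<Rightarrow> nat \<Rightarrow> 'a" where
  "qpochhammer x p k = (\<Prod>j<k. 1 - x * p ^ j)"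

text \<open>The multi-parameter version: \<open>qpochs [x\<^sub>1, \<dots>, x\<^sub>m] p k\<close> is \<open>(x\<^sub>1, \<dots>, x\<^sub>m; p)\<^sub>k\<close>.\<close>

definition qpochs :: "'a::comm_ring_1 list \<Rightarrow> 'a \<Rightarrow> nat \<Rightarrow> 'a" where
  "qpochs xs p k = (\<Prod>x\<leftarrow>xs. qpochhammer x p k)"

text \<open>\<open>qint q m\<close> is the \<open>q\<close>-integer \<open>[m] = 1 + q + \<dots> + q\<^bsup>m-1\<^esup>\<close>.\<close>

definition qint :: "'a::comm_ring_1 \<Rightarrow> nat \<Rightarrow> 'a" where
  "qint q m = (\<Sum>i<m. q ^ i)"

text \<open>
  \<^const>\<open>quot_of_fract\<close> yields the reduced (coprime) numerator and denominator. The divisibility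
  is in the polynomial ring, not in its fraction field.
\<close>

definition fract_cong ::
  "'a::{ring_gcd, idom_divide, semiring_gcd_mult_normalize} fract \<Rightarrow> 'a fract \<Rightarrow> 'a \<Rightarrow> bool" where
  "fract_cong A B P \<longleftrightarrow> P dvd fst (quot_of_fract (A - B))"

end

theory Submission
  imports Defs Complex_Main
begin

text \<open>
  With \<open>x\<^sub>j = q\<^bsup>-2j\<^esup> + A q\<^bsup>2j+1\<^esup>\<close>, \<open>c\<^sub>j = q\<^bsup>-j\<^esup> + A q\<^bsup>j+1\<^esup>\<close> and \<open>X = d + A q / d\<close>, the \<open>d\<close>-dependent part
  \<open>(d, Aq/d; q\<^sup>2)\<^sub>k / (d, Aq/d; q)\<^sub>k\<close> of the \<open>k\<close>-th term is, up to a power of \<open>q\<close>, the product of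
  \<open>(x\<^sub>j - X) / (c\<^sub>j - X)\<close> over \<open>j < k\<close>. Rational Lagrange interpolation in this basis is explicit, and the
  remaining part of the term is the expansion coefficient of a product \<open>\<beta>\<^sub>m\<close> given at the nodes \<open>x\<^sub>m\<close>:
  the corresponding identity is polynomial in \<open>b + A q / (b c)\<close> and can be checked at
  \<open>b = q\<^bsup>-j\<^esup>\<close> (\<open>j < k\<close>) and \<open>b = A q\<^bsup>2k\<^esup>\<close>.
  The sum of the theorem is the case \<open>A = q\<close>, \<open>d = aq\<close>, with \<open>q/b\<close>, \<open>q/c\<close> for \<open>b\<close>, \<open>c\<close>.
  For \<open>a = q\<^bsup>\<plusminus>n\<^esup>\<close> we have \<open>X = x\<^sub>N\<close> with \<open>n = 2N + 1\<close>, and the sum equals \<open>\<beta>\<^sub>N\<close>, the right-hand side.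
  At a root of unity of order \<open>2N + 1\<close> every Lagrange weight or the value \<open>\<beta>\<^sub>N\<close> vanishes, so the sum over
  one block is \<open>0\<close> for every \<open>a\<close>; sums over several blocks are multiples of it by periodicity.
\<close>

section \<open>q-Pochhammer symbols\<close>

lemma qpochhammer_0 [simp]: "qpochhammer x p 0 = 1"
  by (simp add: qpochhammer_def)

lemma qpochhammer_Suc [simp]: "qpochhammer x p (Suc k) = qpochhammer x p k * (1 - x * p ^ k)"
  by (simp add: qpochhammer_def)

lemma qpochhammer_add: "qpochhammer x p (m + k) = qpochhammer x p m * qpochhammer (x * p ^ m) p k"
  by (induction k) (simp_all add: power_add mult_ac)

lemma qpochhammer_swap:
  "qpochhammer u p m * qpochhammer (u * p ^ m) p s = qpochhammer u p s * qpochhammer (u * p ^ s) p m"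
  by (metis qpochhammer_add add.commute)

lemma qpochhammer_double:
  "qpochhammer x p (2 * k) = qpochhammer x (p ^ 2) k * qpochhammer (x * p) (p ^ 2) k"
  by (induction k) (simp_all add: power_mult [symmetric] mult_ac)

lemma qpochhammer_eq_0_iff:
  fixes x :: "'a :: idom"
  shows "qpochhammer x p k = 0 \<longleftrightarrow> (\<exists>j<k. x * p ^ j = 1)"
  by (auto simp: qpochhammer_def)

lemma qint_mult: "(1 - q) * qint q m = 1 - q ^ m"
  by (simp add: qint_def one_diff_power_eq)

lemma power_diff_eq_1:
  fixes q :: "'a::field"
  assumes "q \<noteq> 0" "i \<le> j" "q ^ i = q ^ j"
  shows "q ^ (j - i) = 1"
proof -
  have "q ^ j = q ^ i * q ^ (j - i)" using assms(2) by (simp flip: power_add)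
  then show ?thesis using assms by simp
qed

lemma mult_power_div_power_ne_1:
  fixes q c :: "'a::field"
  assumes "q \<noteq> 0" "\<And>i. c * q ^ i \<noteq> 1" "\<And>i. q ^ i \<noteq> c"
  shows "c * q ^ i / q ^ j \<noteq> 1"
proof
  assume "c * q ^ i / q ^ j = 1"
  then have e: "c * q ^ i = q ^ j" using assms(1) by simp
  show False
  proof (cases "i < j")
    case True
    then have "q ^ j = q ^ (j - i) * q ^ i" by (simp flip: power_add)
    then show False using e assms(1,3) by auto
  next
    case False
    then have "q ^ i = q ^ (i - j) * q ^ j" by (simp flip: power_add)
    then show False using e assms(1) assms(2) [of "i - j"] by auto
  qed
qed

text \<open>The shape \<open>q * x * x\<close> with \<open>x = q ^ (2 * j + 1)\<close> is the one
  that occurs in \<open>pair_numerator\<close> and \<open>pair_denominator\<close>.\<close>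

lemma power_4_3: "q ^ (4 * j + 3) = q * q ^ (2 * j + 1) * (q::'a::monoid_mult) ^ (2 * j + 1)"
proof -
  have "4 * j + 3 = Suc ((2 * j + 1) + (2 * j + 1))" by simp
  then show ?thesis by (metis power_Suc power_add mult.assoc)
qed

section \<open>Rational Lagrange interpolation\<close>

text \<open>If \<open>f(X)\<close> is the sum of
  \<open>u_k * prod_{j<k} (x_j - X) / (c_j - X)\<close>, then \<open>u_k\<close> is the sum of
  \<open>lagr_inv x c k m * f(x_m)\<close> over \<open>m \<le> k\<close>: these are the entries of
  the inverse of the triangular matrix of basis values at the nodes. For \<open>k > 0\<close>,
  \<open>u_k\<close> is up to sign \<open>c (k - 1) - x k\<close> times the divided difference of
  \<open>f * prod_{j<k-1} (c_j - X)\<close> at \<open>x_0, ..., x_k\<close>.\<close>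

definition lagr_inv :: "(nat \<Rightarrow> 'a::field) \<Rightarrow> (nat \<Rightarrow> 'a) \<Rightarrow> nat \<Rightarrow> nat \<Rightarrow> 'a" where
  "lagr_inv x c k m = (if k = 0 then 1 else
     (c (k - 1) - x k) * (\<Prod>j<k - 1. c j - x m) / (\<Prod>j\<in>{..k} - {m}. x j - x m))"

lemma lagr_inv_diag: "lagr_inv x c k k = (\<Prod>j<k. c j - x k) / (\<Prod>j<k. x j - x k)"
proof (cases k)
  case (Suc l)
  have "{..k} - {k} = {..<k}" by auto
  then show ?thesis using Suc by (simp add: lagr_inv_def mult_ac)
qed (simp add: lagr_inv_def)

text \<open>The sum telescopes: its next summand is the sum so far times \<open>(x m - X) * (c n - x
  (Suc n)) / ((c n - X) * (x (Suc n) - x m))\<close>, and one plus this factor splits into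
  \<open>(x (Suc n) - X) / (x (Suc n) - x m)\<close> and \<open>(c n - x m) / (c n - X)\<close>. The
  closed form is the Lagrange weight of the node \<open>x m\<close>.\<close>

lemma rational_lagrange:
  fixes x c :: "nat \<Rightarrow> 'a::field"
  assumes "m \<le> n" "\<And>j. j < n \<Longrightarrow> c j \<noteq> X" "inj_on x {..n}"
  shows "(\<Sum>k=m..n. (\<Prod>j<k. (x j - X) / (c j - X)) * lagr_inv x c k m) =
    (\<Prod>j\<in>{..n} - {m}. (x j - X) / (x j - x m)) * (\<Prod>j<n. (c j - x m) / (c j - X))"
  using assms
proof (induction n rule: dec_induct)
  case base
  have "{..m} - {m} = {..<m}" by auto
  then show ?case using base by (simp add: lagr_inv_diag prod_dividef)
next
  case (step n)
  define L where "L = (\<Prod>j\<in>{..n} - {m}. (x j - X) / (x j - x m)) * (\<Prod>j<n. (c j - x m) / (c j - X))"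
  have IH: "(\<Sum>k=m..n. (\<Prod>j<k. (x j - X) / (c j - X)) * lagr_inv x c k m) = L"
    unfolding L_def using step by (intro step.IH) (auto simp: inj_on_def)
  have ne: "x (Suc n) \<noteq> x m" using step(1) inj_onD [OF step.prems(2), of "Suc n" m] by auto
  have cn: "c n \<noteq> X" using step by auto
  have S: "{..Suc n} - {m} = insert (Suc n) ({..n} - {m})" using step by auto
  have T: "{..n} = insert m ({..n} - {m})" using step by auto
  \<comment> \<open>The denominator of \<open>lagr_inv\<close> omits the index \<open>m\<close>, so
    the factor \<open>x m - X\<close> is split off to leave the product in \<open>L\<close>.\<close>
  have P: "(\<Prod>j<Suc n. x j - X) = (x m - X) * (\<Prod>j\<in>{..n} - {m}. x j - X)"
    by (subst lessThan_Suc_atMost, subst T, subst prod.insert) auto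
  have R: "(\<Prod>j<Suc n. (x j - X) / (c j - X)) * lagr_inv x c (Suc n) m
     = L * ((x m - X) * (c n - x (Suc n)) / ((c n - X) * (x (Suc n) - x m)))"
    unfolding lagr_inv_def prod_dividef P S L_def using step(1)
    by (simp add: prod_dividef divide_simps)
  have "(\<Sum>k=m..Suc n. (\<Prod>j<k. (x j - X) / (c j - X)) * lagr_inv x c k m)
     = L + L * ((x m - X) * (c n - x (Suc n)) / ((c n - X) * (x (Suc n) - x m)))"
    using step(1) IH R by simp
  also have "\<dots> = L * ((x (Suc n) - X) / (x (Suc n) - x m) * ((c n - x m) / (c n - X)))"
    using ne cn by (simp add: divide_simps) (simp add: algebra_simps)
  also have "\<dots> = (\<Prod>j\<in>{..Suc n} - {m}. (x j - X) / (x j - x m)) * (\<Prod>j<Suc n. (c j - x m) / (c j - X))"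
    unfolding S L_def by (subst prod.insert) (auto simp: mult_ac)
  finally show ?case .
qed

text \<open>Up to sign the sum is the coefficient of degree \<open>k\<close> of the Lagrange
  interpolant of \<open>p\<close> at \<open>k + 1\<close> nodes. As \<open>degree p < k\<close>, the
  interpolant is \<open>p\<close> itself and has no such term.\<close>

lemma lagrange_leading_coeff:
  fixes x :: "nat \<Rightarrow> 'a::field"
  assumes inj: "inj_on x {..k}" and deg: "degree p < k"
  shows "(\<Sum>m\<le>k. poly p (x m) / (\<Prod>j\<in>{..k} - {m}. x j - x m)) = 0"
proof -
  define w where "w m = poly p (x m) / (\<Prod>j\<in>{..k} - {m}. x j - x m)" for m
  define r where "r m = (\<Prod>j\<in>{..k} - {m}. [:x j, -1:])" for m
  define s where "s = (\<Sum>m\<le>k. smult (w m) (r m)) - p"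
  have degr: "degree (r m) = k" and cr: "lead_coeff (r m) = (-1) ^ k" if "m \<le> k" for m
  proof -
    have "card ({..k} - {m}) = k" using that by simp
    then show "degree (r m) = k"
      unfolding r_def by (simp add: degree_prod_eq_sum_degree)
    show "lead_coeff (r m) = (-1) ^ k"
      unfolding r_def lead_coeff_prod using \<open>card ({..k} - {m}) = k\<close> by simp
  qed
  have z: "poly s (x i) = 0" if "i \<le> k" for i
  proof -
    have "poly (r m) (x i) = 0" if "m \<noteq> i" for m
      using that \<open>i \<le> k\<close> unfolding r_def poly_prod by (intro prod_zero) auto
    then have "(\<Sum>m\<le>k. w m * poly (r m) (x i)) = w i * poly (r i) (x i)"
      using \<open>i \<le> k\<close> by (subst sum.remove [of _ i]) auto
    also have "\<dots> = poly p (x i)"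
    proof -
      have "(\<Prod>j\<in>{..k} - {i}. x j - x i) \<noteq> 0"
        using inj \<open>i \<le> k\<close> by (auto simp: inj_on_def)
      then show ?thesis unfolding w_def r_def poly_prod by simp
    qed
    finally show ?thesis by (simp add: s_def poly_sum)
  qed
  have "degree s \<le> k"
    unfolding s_def by (intro degree_diff_le degree_sum_le) (use deg degr in \<open>auto intro: order.trans [OF degree_smult_le]\<close>)
  have "s = 0"
  proof (rule ccontr)
    assume "s \<noteq> 0"
    have "card (x ` {..k}) \<le> card {y. poly s y = 0}"
      using z by (intro card_mono poly_roots_finite \<open>s \<noteq> 0\<close>) auto
    also have "\<dots> \<le> degree s" using \<open>s \<noteq> 0\<close> by (rule card_poly_roots_bound)
    finally show False using \<open>degree s \<le> k\<close> card_image [OF inj] by simp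
  qed
  then have "0 = coeff s k" by simp
  also have "\<dots> = (\<Sum>m\<le>k. w m * (-1) ^ k)"
    using deg cr degr by (simp add: s_def coeff_sum coeff_eq_0)
  also have "\<dots> = (\<Sum>m\<le>k. w m) * (-1) ^ k"
    by (rule sum_distrib_right [symmetric])
  finally show ?thesis by (simp add: w_def)
qed

section \<open>The inverse expansion\<close>

definition xnode :: "'a::field \<Rightarrow> 'a \<Rightarrow> nat \<Rightarrow> 'a" where
  "xnode q A j = 1 / q ^ (2 * j) + A * q ^ (2 * j + 1)"

definition cpole :: "'a::field \<Rightarrow> 'a \<Rightarrow> nat \<Rightarrow> 'a" where
  "cpole q A j = 1 / q ^ j + A * q ^ (j + 1)"

definition beta_gen :: "'a::field \<Rightarrow> 'a \<Rightarrow> 'a \<Rightarrow> 'a \<Rightarrow> nat \<Rightarrow> 'a" where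
  "beta_gen q A b c m =
    qpochs [A * q ^ 2, b * q, c * q, A * q ^ 2 / (b * c)] (q ^ 2) m /
    qpochs [q, A * q ^ 2 / b, A * q ^ 2 / c, b * c * q] (q ^ 2) m"

text \<open>\<open>alpha_gen\<close> is the \<open>d\<close>-free part of the term, and
  \<open>beta_gen\<close> the closed form, in Rahman's quadratic summation. The last product makes
  up for the power of \<open>q\<close> that arises when Pochhammer symbols in \<open>d\<close> are
  replaced by differences of nodes, see \<open>poch_shift_pair\<close>.\<close>

definition alpha_gen :: "'a::field \<Rightarrow> 'a \<Rightarrow> 'a \<Rightarrow> 'a \<Rightarrow> nat \<Rightarrow> 'a" where
  "alpha_gen q A b c k = (1 - A * q ^ (3 * k)) / (1 - A) *
    (qpochhammer A (q ^ 2) k * qpochs [b, c, A * q / (b * c)] q k) /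
    (qpochhammer q q k * qpochs [A * q ^ 2 / b, A * q ^ 2 / c, b * c * q] (q ^ 2) k) *
    q ^ k * (\<Prod>j<k. q ^ j)"

lemma cpole_even: "cpole q A (2 * m) = xnode q A m"
  by (simp add: cpole_def xnode_def)

text \<open>\<open>d + A * q / d\<close> takes the value of the node at
  \<open>d = 1 / q ^ (2 * j)\<close> and is invariant under exchanging \<open>d\<close> with
  \<open>A * q / d\<close>; these two zeros give the two factors.\<close>

lemma xnode_diff:
  fixes q A d :: "'a::field"
  assumes "q \<noteq> 0" "d \<noteq> 0"
  shows "q ^ (2 * j) * (xnode q A j - (d + A * q / d)) = (1 - d * q ^ (2 * j)) * (1 - A * q / d * q ^ (2 * j))"
  using assms by (simp add: xnode_def divide_simps) (simp add: algebra_simps)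

lemma cpole_diff:
  fixes q A d :: "'a::field"
  assumes "q \<noteq> 0" "d \<noteq> 0"
  shows "q ^ j * (cpole q A j - (d + A * q / d)) = (1 - d * q ^ j) * (1 - A * q / d * q ^ j)"
  using assms by (simp add: cpole_def divide_simps) (simp add: algebra_simps)

lemma xnode_alt: "q \<noteq> 0 \<Longrightarrow> xnode q A m = 1 / q ^ (2 * m) + A * q / (1 / q ^ (2 * m))"
  by (simp add: xnode_def)

text \<open>Each factor is multiplied by \<open>v * q ^ k\<close>, then the order of the factors is
  reversed.\<close>

lemma qpochhammer_reflect:
  fixes q v :: "'a::field"
  assumes "q \<noteq> 0" "v \<noteq> 0"
  shows "(\<Prod>j<k. 1 - q ^ (j + 1) / (v * q ^ k)) * (\<Prod>j<k. v * q ^ k) =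
    qpochhammer v q k * (\<Prod>j<k. - (q ^ (j + 1)))"
proof -
  have "(\<Prod>j<k. 1 - q ^ (j + 1) / (v * q ^ k)) * (\<Prod>j<k. v * q ^ k) = (\<Prod>j<k. v * q ^ k - q ^ (j + 1))"
    unfolding prod.distrib [symmetric] using assms by (intro prod.cong) (auto simp: field_simps)
  also have "\<dots> = (\<Prod>j<k. (1 - v * q ^ (k - 1 - j)) * (- (q ^ (j + 1))))"
  proof (rule prod.cong)
    fix j assume "j \<in> {..<k}"
    then have "k = (k - 1 - j) + (j + 1)" by auto
    then have "q ^ k = q ^ (k - 1 - j) * q ^ (j + 1)" by (metis power_add)
    then show "v * q ^ k - q ^ (j + 1) = (1 - v * q ^ (k - 1 - j)) * (- (q ^ (j + 1)))"
      by (simp add: algebra_simps)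
  qed simp
  also have "\<dots> = (\<Prod>j<k. 1 - v * q ^ (k - 1 - j)) * (\<Prod>j<k. - (q ^ (j + 1)))"
    by (rule prod.distrib)
  also have "(\<Prod>j<k. 1 - v * q ^ (k - 1 - j)) = qpochhammer v q k"
    unfolding qpochhammer_def by (subst prod.nat_diff_reindex [symmetric]) simp
  finally show ?thesis .
qed

text \<open>The \<open>A\<close>-free part of the comparison of the terms with \<open>m = k\<close>
  at \<open>b = A * q ^ (2 * k)\<close>. All four products are reflected, and the resulting symbols
  match because a symbol of length \<open>2 * k\<close> in base \<open>q\<close> can be split in the
  middle or by the parity of the exponent.\<close>

lemma reflect_quotient:
  fixes q c :: "'a::field"
  assumes q: "q \<noteq> 0" "c \<noteq> 0" and ne: "qpochhammer q q (2 * k) \<noteq> 0"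
    and R2: "(\<Prod>j<k. 1 - q ^ (2 * j) / q ^ (2 * k)) \<noteq> 0"
  shows "(\<Prod>j<k. 1 - q ^ j / q ^ (2 * k)) / (\<Prod>j<k. 1 - q ^ (2 * j) / q ^ (2 * k)) *
      (\<Prod>j<k. 1 - q ^ (2 * j + 2) / (c * q ^ (2 * k))) *
      (qpochhammer (c * q) (q ^ 2) k / qpochhammer q (q ^ 2) k) =
    (\<Prod>j<k. 1 - q ^ (j + 1) / (c * q ^ (2 * k))) * (qpochhammer c q k / qpochhammer q q k) * q ^ k"
    (is "?R1 / ?R2 * ?R3 * _ = ?R4 * _ * _")
proof -
  define Q where "Q = q ^ (2 * k)"
  define s1 where "s1 = (\<Prod>j<k. - (q ^ (j + 1)))"
  define s2 where "s2 = (\<Prod>j<k. - ((q ^ 2) ^ (j + 1)))"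
  have Q: "Q \<noteq> 0" "q ^ k * q ^ k = Q" using q by (simp_all add: Q_def power_add mult_2)
  have s: "s1 \<noteq> 0" "s2 \<noteq> 0" using q by (auto simp: s1_def s2_def)
  have Q2: "q * q ^ k * q ^ k = q * Q" "c * q ^ k * q ^ k = c * Q" using Q(2) by (simp_all only: mult.assoc)
  have Q3: "(q ^ 2) ^ k = Q" "(q ^ 2) ^ (j + 1) = q ^ (2 * j + 2)" for j
    unfolding Q_def power_mult [symmetric] by simp_all
  have qQ: "q ^ (j + 1) / (q * Q) = q ^ j / Q" "q ^ (2 * j + 2) / (q ^ 2 * Q) = q ^ (2 * j) / Q" for j
    using q by (simp_all add: power2_eq_square)
  have a1: "?R1 * (q * Q) ^ k = qpochhammer (q * q ^ k) q k * s1"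
    using qpochhammer_reflect [of q "q * q ^ k" k] q unfolding s1_def Q_def [symmetric] Q2 qQ by simp
  have a2: "?R2 * (q ^ 2 * Q) ^ k = qpochhammer (q ^ 2) (q ^ 2) k * s2"
    using qpochhammer_reflect [of "q ^ 2" "q ^ 2" k] q unfolding s2_def Q_def [symmetric] Q3 qQ by simp
  have a3: "?R3 * (c * Q) ^ k = qpochhammer c (q ^ 2) k * s2"
    using qpochhammer_reflect [of "q ^ 2" c k] q unfolding s2_def Q_def [symmetric] Q3 by simp
  have a4: "?R4 * (c * Q) ^ k = qpochhammer (c * q ^ k) q k * s1"
    using qpochhammer_reflect [of q "c * q ^ k" k] q unfolding s1_def Q_def [symmetric] Q2 by simp
  have b1: "qpochhammer q q k * qpochhammer (q * q ^ k) q k = qpochhammer q (q ^ 2) k * qpochhammer (q ^ 2) (q ^ 2) k"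
    using qpochhammer_add [of q q k k] qpochhammer_double [of q q k] unfolding mult_2 power2_eq_square by simp
  have b2: "qpochhammer c q k * qpochhammer (c * q ^ k) q k = qpochhammer c (q ^ 2) k * qpochhammer (c * q) (q ^ 2) k"
    using qpochhammer_add [of c q k k] qpochhammer_double [of c q k] unfolding mult_2 by simp
  have n: "qpochhammer q q k \<noteq> 0" "qpochhammer q (q ^ 2) k \<noteq> 0" "qpochhammer (q ^ 2) (q ^ 2) k \<noteq> 0"
    using ne qpochhammer_add [of q q k k] qpochhammer_double [of q q k]
    unfolding mult_2 power2_eq_square by auto
  define W where "W = (c * Q) ^ k * (q * Q) ^ k * (q ^ 2 * Q) ^ k"
  have W: "W \<noteq> 0" using q Q by (simp add: W_def)
  have "?R1 * ?R3 * qpochhammer (c * q) (q ^ 2) k * qpochhammer q q k * W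
    = (?R1 * (q * Q) ^ k) * (?R3 * (c * Q) ^ k) * qpochhammer (c * q) (q ^ 2) k * qpochhammer q q k * (q ^ 2 * Q) ^ k"
    by (simp add: W_def mult_ac)
  also have "\<dots> = (qpochhammer q q k * qpochhammer (q * q ^ k) q k) * (qpochhammer c (q ^ 2) k * qpochhammer (c * q) (q ^ 2) k) * s1 * s2 * (q ^ 2 * Q) ^ k"
    unfolding a1 a3 by (simp only: mult_ac)
  also have "\<dots> = (?R4 * (c * Q) ^ k) * (?R2 * (q ^ 2 * Q) ^ k) * qpochhammer c q k * qpochhammer q (q ^ 2) k * (q ^ 2 * Q) ^ k"
    unfolding a2 a4 b1 b2 [symmetric] by (simp only: mult_ac)
  also have "\<dots> = (?R4 * ?R2 * qpochhammer c q k * qpochhammer q (q ^ 2) k) * ((c * Q) ^ k * (q ^ 2 * Q) ^ k * (q ^ 2 * Q) ^ k)"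
    by (simp only: mult_ac)
  \<comment> \<open>The factor \<open>q ^ k\<close> of the claim arises here, from
    \<open>(q ^ 2 * Q) ^ k = q ^ k * (q * Q) ^ k\<close>.\<close>
  also have "(c * Q) ^ k * (q ^ 2 * Q) ^ k * (q ^ 2 * Q) ^ k = q ^ k * W"
    unfolding W_def power2_eq_square power_mult_distrib by (simp only: mult_ac)
  finally have "(?R1 * ?R3 * qpochhammer (c * q) (q ^ 2) k * qpochhammer q q k) * W =
      (?R4 * ?R2 * qpochhammer c q k * qpochhammer q (q ^ 2) k * q ^ k) * W"
    by (simp only: mult.assoc)
  then have *: "?R1 * ?R3 * qpochhammer (c * q) (q ^ 2) k * qpochhammer q q k =
      ?R4 * ?R2 * qpochhammer c q k * qpochhammer q (q ^ 2) k * q ^ k"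
    by (rule mult_right_cancel [OF W, THEN iffD1])
  have frac: "r1 / r2 * r3 * (x / y) = r4 * (u / v) * w"
    if "r1 * r3 * x * v = r4 * r2 * u * y * w" "r2 \<noteq> 0" "y \<noteq> 0" "v \<noteq> 0" for r1 r2 r3 r4 x y u v w :: 'a
    using that by (simp add: divide_simps mult_ac)
  show ?thesis by (rule frac [OF * R2 n(2,1)])
qed

section \<open>The expansion at b = q^(-2s)\<close>

definition evenfac :: "'a::field \<Rightarrow> 'a \<Rightarrow> nat \<Rightarrow> 'a \<Rightarrow> nat \<Rightarrow> 'a" where
  "evenfac q A s v m = (\<Prod>i<s. (1 - v * q ^ (2 * m) / q ^ (2 * i + 1)) * (1 - A * q ^ (2 * i + 2) * q ^ (2 * m) / v))"

text \<open>Up to a power of \<open>q\<close>, \<open>evenfac\<close> is a polynomial of degree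
  \<open>s\<close> in the node. For \<open>v = 1\<close> its zeros are the odd-indexed poles
  \<open>cpole q A (2 * i + 1)\<close> with \<open>i < s\<close>.\<close>

lemma evenfac_xnode:
  fixes q A v :: "'a::field"
  assumes "q \<noteq> 0" "v \<noteq> 0"
  shows "evenfac q A s v m = (q ^ (2 * m)) ^ s * (\<Prod>i<s. xnode q A m - (v / q ^ (2 * i + 1) + A * q ^ (2 * i + 2) / v))"
proof -
  have "evenfac q A s v m = (\<Prod>i<s. q ^ (2 * m) * (xnode q A m - (v / q ^ (2 * i + 1) + A * q ^ (2 * i + 2) / v)))"
    unfolding evenfac_def
  proof (rule prod.cong)
    fix i
    define z w where "z = q ^ (2 * m)" and "w = q ^ (2 * i + 1)"
    have "z \<noteq> 0" "w \<noteq> 0" using assms by (simp_all add: z_def w_def)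
    moreover have "q ^ (2 * i + 2) = q * w" "q ^ (2 * m + 1) = q * z" by (simp_all add: z_def w_def)
    ultimately show "(1 - v * q ^ (2 * m) / q ^ (2 * i + 1)) * (1 - A * q ^ (2 * i + 2) * q ^ (2 * m) / v) =
      q ^ (2 * m) * (xnode q A m - (v / q ^ (2 * i + 1) + A * q ^ (2 * i + 2) / v))"
      unfolding xnode_def z_def [symmetric] w_def [symmetric] using assms
      by (simp add: divide_simps) (simp add: algebra_simps)
  qed simp
  then show ?thesis by (simp add: prod.distrib)
qed

lemma evenfac_qpochhammer:
  fixes q A v :: "'a::field"
  assumes q: "q \<noteq> 0"
  shows "evenfac q A s v m = qpochhammer (v * q / q ^ (2 * s) * (q ^ 2) ^ m) (q ^ 2) s * qpochhammer (A * q ^ 2 / v * (q ^ 2) ^ m) (q ^ 2) s"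
proof -
  have "(\<Prod>i<s. 1 - v * q ^ (2 * m) / q ^ (2 * i + 1)) = (\<Prod>i<s. 1 - v * q ^ (2 * m) / q ^ (2 * (s - Suc i) + 1))"
    by (rule prod.nat_diff_reindex [symmetric])
  also have "\<dots> = qpochhammer (v * q / q ^ (2 * s) * (q ^ 2) ^ m) (q ^ 2) s"
    unfolding qpochhammer_def
  proof (rule prod.cong)
    fix i assume "i \<in> {..<s}"
    then have "2 * s = (2 * (s - Suc i) + 1) + (2 * i + 1)" by auto
    then have "q ^ (2 * s) = q ^ (2 * (s - Suc i) + 1) * q ^ (2 * i + 1)" by (metis power_add)
    then show "1 - v * q ^ (2 * m) / q ^ (2 * (s - Suc i) + 1) = 1 - v * q / q ^ (2 * s) * (q\<^sup>2) ^ m * (q\<^sup>2) ^ i"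
      using q by (simp add: power_mult [symmetric] mult_ac)
  qed simp
  finally have 1: "(\<Prod>i<s. 1 - v * q ^ (2 * m) / q ^ (2 * i + 1)) = qpochhammer (v * q / q ^ (2 * s) * (q ^ 2) ^ m) (q ^ 2) s" .
  have 2: "(\<Prod>i<s. 1 - A * q ^ (2 * i + 2) * q ^ (2 * m) / v) = qpochhammer (A * q ^ 2 / v * (q ^ 2) ^ m) (q ^ 2) s"
    unfolding qpochhammer_def by (intro prod.cong) (auto simp: power_mult [symmetric] power_add mult_ac, auto simp: power2_eq_square)
  show ?thesis unfolding evenfac_def prod.distrib 1 2 ..
qed

text \<open>Two instances of \<open>qpochhammer_swap\<close>: a symbol of length
  \<open>m + s\<close> is split after \<open>m\<close> or after \<open>s\<close> factors. This
  trades symbols whose length depends on \<open>m\<close> for products of fixed length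
  \<open>s\<close>.\<close>

lemma evenfac_ratio:
  fixes q A v :: "'a::field"
  assumes q: "q \<noteq> 0"
  shows "qpochhammer (v * q) (q ^ 2) m * qpochhammer (A * q ^ (2 * s + 2) / v) (q ^ 2) m * evenfac q A s v 0 =
    qpochhammer (v * q / q ^ (2 * s)) (q ^ 2) m * qpochhammer (A * q ^ 2 / v) (q ^ 2) m * evenfac q A s v m"
proof -
  have 1: "v * q / q ^ (2 * s) * (q ^ 2) ^ s = v * q" "A * q ^ 2 / v * (q ^ 2) ^ s = A * q ^ (2 * s + 2) / v"
    using q unfolding power_mult [symmetric] by (simp_all add: power_add power2_eq_square)
  note sw = qpochhammer_swap [of "v * q / q ^ (2 * s)" "q ^ 2" m s, unfolded 1]
    qpochhammer_swap [of "A * q ^ 2 / v" "q ^ 2" m s, unfolded 1]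
  have alg: "a * b * (c * d) = e * f * (g * h)" if "e * g = c * a" "f * h = d * b"
    for a b c d e f g h :: 'a
    using that by algebra
  show ?thesis unfolding evenfac_qpochhammer [OF q]
    using alg [OF sw] by simp
qed

text \<open>For \<open>b = 1 / q ^ (2 * s)\<close> the symbols pair up by
  \<open>evenfac_ratio\<close> with \<open>v = c\<close> and \<open>v = 1\<close>. By
  \<open>evenfac_xnode\<close> the value is then a rational function of the node, with numerator and
  denominator of degree \<open>s\<close>.\<close>

lemma beta_gen_even:
  fixes q A c :: "'a::field"
  assumes q: "q \<noteq> 0" "c \<noteq> 0"
    and A: "\<And>i. A * q ^ i \<noteq> 1" "\<And>i. A * q ^ i \<noteq> c"
    and c: "\<And>i. c * q ^ i \<noteq> 1" "\<And>i. q ^ i \<noteq> c"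
    and qi: "\<And>i. 0 < i \<Longrightarrow> i \<le> K \<Longrightarrow> q ^ i \<noteq> 1"
    and m: "2 * m \<le> K" "2 * s \<le> K"
  shows "beta_gen q A (1 / q ^ (2 * s)) c m = evenfac q A s 1 0 / evenfac q A s c 0 *
    (evenfac q A s c m / evenfac q A s 1 m)" and "evenfac q A s 1 m \<noteq> 0"
proof -
  have pw: "q ^ i / q ^ j \<noteq> 1" if "i \<noteq> j" "i \<le> K" "j \<le> K" for i j
  proof
    assume "q ^ i / q ^ j = 1"
    then have e: "q ^ i = q ^ j" using q by simp
    show False
      using power_diff_eq_1 [OF q(1) _ e] power_diff_eq_1 [OF q(1) _ e [symmetric]] qi [of "j - i"] qi [of "i - j"] that
      by (cases "i < j") auto
  qed
  have cq: "c * q ^ i / q ^ j \<noteq> 1" for i j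
    by (rule mult_power_div_power_ne_1 [OF q(1) c])
  \<comment> \<open>The exponents differ by parity, and both are at most \<open>K\<close>.\<close>
  have odd_ne: "q ^ (2 * m') / q ^ (2 * i + 1) \<noteq> 1" if "i < s" "2 * m' \<le> K" for i m'
    using that m by (intro pw) presburger+
  have ev1: "evenfac q A s 1 m' \<noteq> 0" if "2 * m' \<le> K" for m'
  proof -
    have "A * q ^ i * q ^ j \<noteq> 1" for i j using A(1) [of "i + j"] by (simp add: power_add mult.assoc)
    then show ?thesis using odd_ne [OF _ that] unfolding evenfac_def by (auto simp del: power_Suc)
  qed
  have evc: "evenfac q A s c 0 \<noteq> 0"
  proof -
    have "c / q ^ i \<noteq> 1" "A * q ^ i / c \<noteq> 1" for i using cq [of 0 i] A(2) [of i] q by auto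
    then show ?thesis by (auto simp: evenfac_def simp flip: power_Suc)
  qed
  show "evenfac q A s 1 m \<noteq> 0" by (rule ev1 [OF m(1)])
  have n1: "qpochhammer q (q ^ 2) m \<noteq> 0"
    using m(1) qi by (auto simp: qpochhammer_eq_0_iff simp flip: power_mult power_Suc)
  have n2: "qpochhammer (A * q ^ i) (q ^ 2) m \<noteq> 0" for i
    using A by (auto simp: qpochhammer_eq_0_iff mult.assoc simp flip: power_mult power_add)
  have "A * q ^ 2 / c * (q ^ 2) ^ j \<noteq> 1" for j
  proof -
    have "A * q ^ 2 / c * (q ^ 2) ^ j = A * q ^ (2 + 2 * j) / c"
      unfolding power_mult [symmetric] by (simp add: power_add power2_eq_square)
    then show ?thesis using A(2) [of "2 + 2 * j"] q by auto
  qed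
  then have n3: "qpochhammer (A * q ^ 2 / c) (q ^ 2) m \<noteq> 0"
    by (auto simp: qpochhammer_eq_0_iff)
  have n4: "qpochhammer (c * q / q ^ (2 * s)) (q ^ 2) m \<noteq> 0"
    using cq [of "Suc (2 * j)" "2 * s" for j] q by (auto simp: qpochhammer_eq_0_iff mult.assoc simp flip: power_mult power_add)
  have frac: "(a2 * b1 * c1 * d2) / (a1 * b2 * c2 * d1) = e10 / ec0 * (ecm / e1m)"
    if "c1 * d2 * ec0 = d1 * c2 * ecm" "a1 * b2 * e10 = b1 * a2 * e1m"
      "ec0 \<noteq> 0" "e1m \<noteq> 0" "a1 \<noteq> 0" "b2 \<noteq> 0" "c2 \<noteq> 0" "d1 \<noteq> 0"
    for a1 a2 b1 b2 c1 c2 d1 d2 e10 ec0 ecm e1m :: 'a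
  proof -
    have 1: "c1 * d2 / (c2 * d1) = ecm / ec0" using that by (simp add: divide_simps mult_ac)
    have 2: "a2 * b1 / (a1 * b2) = e10 / e1m" using that by (simp add: divide_simps mult_ac)
    have "(a2 * b1 * c1 * d2) / (a1 * b2 * c2 * d1) = (a2 * b1 / (a1 * b2)) * (c1 * d2 / (c2 * d1))"
      by (simp add: mult.assoc)
    then show ?thesis unfolding 1 2 by simp
  qed
  have eqs: "A * q\<^sup>2 / (1 / q ^ (2 * s)) = A * q ^ (2 * s + 2)" "A * q\<^sup>2 / (1 / q ^ (2 * s) * c) = A * q ^ (2 * s + 2) / c"
    by (simp_all add: power_add power2_eq_square mult_ac)
  show "beta_gen q A (1 / q ^ (2 * s)) c m = evenfac q A s 1 0 / evenfac q A s c 0 *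
    (evenfac q A s c m / evenfac q A s 1 m)"
    using frac [OF evenfac_ratio [OF q(1), of c m A s] evenfac_ratio [OF q(1), of 1 m A s] evc ev1 [OF m(1)]]
      n1 n2 [of "2 * s + 2"] n3 n4
    unfolding beta_gen_def qpochs_def eqs by (simp add: mult_ac)
qed


text \<open>The denominator of \<open>beta_gen\<close> consists of the poles with indices
  \<open>1, 3, ..., 2 * s - 1\<close>. They all occur in the product over \<open>j < k - 1\<close>
  in \<open>lagr_inv\<close>, because \<open>2 * s < k\<close>. After cancellation a polynomial of
  degree \<open>k - 1\<close> in the node is left, and \<open>lagrange_leading_coeff\<close>
  applies.\<close>

lemma lagrange_beta_even:
  fixes q A c :: "'a::field"
  assumes q: "q \<noteq> 0" "c \<noteq> 0"
    and A: "\<And>i. A * q ^ i \<noteq> 1" "\<And>i. A * q ^ i \<noteq> c"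
    and c: "\<And>i. c * q ^ i \<noteq> 1" "\<And>i. q ^ i \<noteq> c"
    and qi: "\<And>i. 0 < i \<Longrightarrow> i \<le> 2 * k \<Longrightarrow> q ^ i \<noteq> 1"
    and s: "2 * s < k" and inj: "inj_on (xnode q A) {..k}"
  shows "(\<Sum>m\<le>k. lagr_inv (xnode q A) (cpole q A) k m * beta_gen q A (1 / q ^ (2 * s)) c m) = 0"
proof -
  define C where "C = evenfac q A s 1 0 / evenfac q A s c 0"
  define g where "g v i = v / q ^ (2 * i + 1) + A * q ^ (2 * i + 2) / v" for v i
  have g1: "g 1 i = cpole q A (2 * i + 1)" for i by (simp add: g_def cpole_def)
  \<comment> \<open>The indices of the factors of \<open>lagr_inv\<close> that survive the
    cancellation.\<close>
  define R where "R = {..<k - 1} - (\<lambda>i. 2 * i + 1) ` {..<s}"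
  have sub: "(\<lambda>i. 2 * i + 1) ` {..<s} \<subseteq> {..<k - 1}" using s by auto
  have cardR: "card R = k - 1 - s"
    unfolding R_def by (subst card_Diff_subset) (use sub in \<open>auto simp: card_image inj_on_def\<close>)
  \<comment> \<open>The sign comes from the cancelled factors, which are node minus pole in
    \<open>evenfac\<close> but pole minus node in \<open>lagr_inv\<close>.\<close>
  define p where "p = smult (C * (-1) ^ s * (cpole q A (k - 1) - xnode q A k))
    ((\<Prod>i<s. [:- g c i, 1:]) * (\<Prod>j\<in>R. [:cpole q A j, -1:]))"
  have "degree p \<le> degree (\<Prod>i<s. [:- g c i, 1:]) + degree (\<Prod>j\<in>R. [:cpole q A j, -1:])"
    unfolding p_def by (rule order.trans [OF degree_smult_le degree_mult_le])
  also have "\<dots> = s + (k - 1 - s)" by (simp add: degree_prod_eq_sum_degree cardR)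
  finally have deg: "degree p < k" using s by simp
  have "lagr_inv (xnode q A) (cpole q A) k m * beta_gen q A (1 / q ^ (2 * s)) c m =
      poly p (xnode q A m) / (\<Prod>j\<in>{..k} - {m}. xnode q A j - xnode q A m)" if m: "m \<le> k" for m
  proof -
    have "2 * m \<le> 2 * k" "2 * s \<le> 2 * k" using m s by auto
    then have be: "beta_gen q A (1 / q ^ (2 * s)) c m = C * (evenfac q A s c m / evenfac q A s 1 m)"
      "evenfac q A s 1 m \<noteq> 0"
      unfolding C_def using beta_gen_even [OF q A c qi] by blast+
    have ne: "(\<Prod>i<s. xnode q A m - cpole q A (2 * i + 1)) \<noteq> 0"
      using be(2) unfolding evenfac_xnode [OF q(1) one_neq_zero] g_def [symmetric] g1 by simp
    have b: "beta_gen q A (1 / q ^ (2 * s)) c m = C * ((\<Prod>i<s. xnode q A m - g c i) / (\<Prod>i<s. xnode q A m - cpole q A (2 * i + 1)))"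
    proof -
      have "evenfac q A s c m = (q ^ (2 * m)) ^ s * (\<Prod>i<s. xnode q A m - g c i)"
        "evenfac q A s 1 m = (q ^ (2 * m)) ^ s * (\<Prod>i<s. xnode q A m - cpole q A (2 * i + 1))"
        unfolding evenfac_xnode [OF q(1) one_neq_zero] evenfac_xnode [OF q] g1 [symmetric]
        by (simp_all add: g_def)
      then show ?thesis unfolding be(1) using q by simp
    qed
    have "(\<Prod>j<k - 1. cpole q A j - xnode q A m) =
      (\<Prod>j\<in>R. cpole q A j - xnode q A m) * (\<Prod>j\<in>(\<lambda>i. 2 * i + 1) ` {..<s}. cpole q A j - xnode q A m)"
      unfolding R_def by (rule prod.subset_diff [OF sub]) simp
    also have "(\<Prod>j\<in>(\<lambda>i. 2 * i + 1) ` {..<s}. cpole q A j - xnode q A m) = (\<Prod>i<s. (-1) * (xnode q A m - cpole q A (2 * i + 1)))"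
      by (subst prod.reindex) (auto simp: inj_on_def)
    also have "\<dots> = (-1) ^ s * (\<Prod>i<s. xnode q A m - cpole q A (2 * i + 1))"
      unfolding prod.distrib by simp
    finally have pr: "(\<Prod>j<k - 1. cpole q A j - xnode q A m) =
      (\<Prod>j\<in>R. cpole q A j - xnode q A m) * ((-1) ^ s * (\<Prod>i<s. xnode q A m - cpole q A (2 * i + 1)))" .
    have "k \<noteq> 0" using s by simp
    then show ?thesis
      unfolding lagr_inv_def b pr p_def using ne by (simp add: poly_prod mult_ac)
  qed
  then have "(\<Sum>m\<le>k. lagr_inv (xnode q A) (cpole q A) k m * beta_gen q A (1 / q ^ (2 * s)) c m)
     = (\<Sum>m\<le>k. poly p (xnode q A m) / (\<Prod>j\<in>{..k} - {m}. xnode q A j - xnode q A m))"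
    by (intro sum.cong) auto
  also have "\<dots> = 0" by (rule lagrange_leading_coeff [OF inj deg])
  finally show ?thesis .
qed

section \<open>Dependence on b through b + A q / (b c)\<close>

lemma pair_numerator:
  fixes A q b c x :: "'a::field"
  assumes "b \<noteq> 0" "c \<noteq> 0"
  shows "(1 - b * x) * (1 - A * q / (b * c) * x) = 1 + A * (q * x * x) / c - x * (b + A * q / (b * c))"
  using assms by (simp add: field_simps)

lemma pair_denominator:
  fixes A q b c x :: "'a::field"
  assumes "b \<noteq> 0" "c \<noteq> 0"
  shows "(1 - A * q / b * x) * (1 - b * c * x) = 1 + A * c * (q * x * x) - c * x * (b + A * q / (b * c))"
  using assms by (simp add: field_simps)

text \<open>Exchanging \<open>b\<close> with \<open>A * q / (b * c)\<close> permutes the factors of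
  each pair, so \<open>b\<close> enters only through \<open>Y\<close>, and linearly in each pair.
  This is what makes the identity for \<open>alpha_gen\<close> polynomial in \<open>Y\<close> after
  clearing denominators.\<close>

lemma beta_gen_prod:
  fixes q A b c :: "'a::field"
  assumes "b \<noteq> 0" "c \<noteq> 0"
  defines "Y \<equiv> b + A * q / (b * c)"
  shows "beta_gen q A b c m =
    qpochhammer (A * q ^ 2) (q ^ 2) m * qpochhammer (c * q) (q ^ 2) m /
    (qpochhammer q (q ^ 2) m * qpochhammer (A * q ^ 2 / c) (q ^ 2) m) *
    ((\<Prod>j<m. 1 + A * q ^ (4 * j + 3) / c - q ^ (2 * j + 1) * Y) /
     (\<Prod>j<m. 1 + A * c * q ^ (4 * j + 3) - c * q ^ (2 * j + 1) * Y))"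
proof -
  have 1: "qpochhammer (b * q) (q ^ 2) m * qpochhammer (A * q ^ 2 / (b * c)) (q ^ 2) m =
    (\<Prod>j<m. 1 + A * q ^ (4 * j + 3) / c - q ^ (2 * j + 1) * Y)"
    unfolding qpochhammer_def prod.distrib [symmetric]
  proof (rule prod.cong)
    fix j
    have q2: "(q ^ 2) ^ j = q ^ (2 * j)" by (simp add: power_mult)
    have "q ^ (4 * j + 3) = q * q ^ (2 * j + 1) * q ^ (2 * j + 1)" by (rule power_4_3)
    moreover have "b * q * (q ^ 2) ^ j = b * q ^ (2 * j + 1)" "b * c * q * (q ^ 2) ^ j = b * c * q ^ (2 * j + 1)"
      "A * q\<^sup>2 / (b * c) * (q\<^sup>2) ^ j = A * q / (b * c) * q ^ (2 * j + 1)"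
      "A * q\<^sup>2 / b * (q\<^sup>2) ^ j = A * q / b * q ^ (2 * j + 1)"
      unfolding q2 by (simp_all add: power2_eq_square)
    ultimately show "(1 - b * q * (q\<^sup>2) ^ j) * (1 - A * q\<^sup>2 / (b * c) * (q\<^sup>2) ^ j) =
         1 + A * q ^ (4 * j + 3) / c - q ^ (2 * j + 1) * Y"
      unfolding Y_def using pair_numerator [OF assms(1,2), of "q ^ (2 * j + 1)" A q] by presburger
  qed simp
  have 2: "qpochhammer (A * q ^ 2 / b) (q ^ 2) m * qpochhammer (b * c * q) (q ^ 2) m =
    (\<Prod>j<m. 1 + A * c * q ^ (4 * j + 3) - c * q ^ (2 * j + 1) * Y)"
    unfolding qpochhammer_def prod.distrib [symmetric]
  proof (rule prod.cong)
    fix j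
    have q2: "(q ^ 2) ^ j = q ^ (2 * j)" by (simp add: power_mult)
    have "q ^ (4 * j + 3) = q * q ^ (2 * j + 1) * q ^ (2 * j + 1)" by (rule power_4_3)
    moreover have "b * q * (q ^ 2) ^ j = b * q ^ (2 * j + 1)" "b * c * q * (q ^ 2) ^ j = b * c * q ^ (2 * j + 1)"
      "A * q\<^sup>2 / (b * c) * (q\<^sup>2) ^ j = A * q / (b * c) * q ^ (2 * j + 1)"
      "A * q\<^sup>2 / b * (q\<^sup>2) ^ j = A * q / b * q ^ (2 * j + 1)"
      unfolding q2 by (simp_all add: power2_eq_square)
    ultimately show "(1 - A * q\<^sup>2 / b * (q\<^sup>2) ^ j) * (1 - b * c * q * (q\<^sup>2) ^ j) =
         1 + A * c * q ^ (4 * j + 3) - c * q ^ (2 * j + 1) * Y"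
      unfolding Y_def using pair_denominator [OF assms(1,2), of A q "q ^ (2 * j + 1)"] by presburger
  qed simp
  show ?thesis unfolding beta_gen_def qpochs_def 1 [symmetric] 2 [symmetric]
    by (simp add: mult_ac)
qed

lemma alpha_gen_prod:
  fixes q A b c :: "'a::field"
  assumes "b \<noteq> 0" "c \<noteq> 0"
  defines "Y \<equiv> b + A * q / (b * c)"
  shows "alpha_gen q A b c k =
    ((1 - A * q ^ (3 * k)) / (1 - A) * (qpochhammer A (q ^ 2) k * qpochhammer c q k) /
    (qpochhammer q q k * qpochhammer (A * q ^ 2 / c) (q ^ 2) k) * q ^ k * (\<Prod>j<k. q ^ j)) *
    ((\<Prod>j<k. 1 + A * q ^ (2 * j + 1) / c - q ^ j * Y) /
     (\<Prod>j<k. 1 + A * c * q ^ (4 * j + 3) - c * q ^ (2 * j + 1) * Y))"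
proof -
  have 1: "qpochhammer b q k * qpochhammer (A * q / (b * c)) q k =
    (\<Prod>j<k. 1 + A * q ^ (2 * j + 1) / c - q ^ j * Y)"
    unfolding qpochhammer_def prod.distrib [symmetric]
  proof (rule prod.cong)
    fix j
    have "q ^ (2 * j + 1) = q * q ^ j * q ^ j"
      by (simp add: mult_2 power_add)
    then show "(1 - b * q ^ j) * (1 - A * q / (b * c) * q ^ j) = 1 + A * q ^ (2 * j + 1) / c - q ^ j * Y"
      unfolding Y_def using pair_numerator [OF assms(1,2), of "q ^ j" A q] by presburger
  qed simp
  have 2: "qpochhammer (A * q ^ 2 / b) (q ^ 2) k * qpochhammer (b * c * q) (q ^ 2) k =
    (\<Prod>j<k. 1 + A * c * q ^ (4 * j + 3) - c * q ^ (2 * j + 1) * Y)"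
    unfolding qpochhammer_def prod.distrib [symmetric]
  proof (rule prod.cong)
    fix j
    have q2: "(q ^ 2) ^ j = q ^ (2 * j)" by (simp add: power_mult)
    have "q ^ (4 * j + 3) = q * q ^ (2 * j + 1) * q ^ (2 * j + 1)" by (rule power_4_3)
    moreover have "b * q * (q ^ 2) ^ j = b * q ^ (2 * j + 1)" "b * c * q * (q ^ 2) ^ j = b * c * q ^ (2 * j + 1)"
      "A * q\<^sup>2 / (b * c) * (q\<^sup>2) ^ j = A * q / (b * c) * q ^ (2 * j + 1)"
      "A * q\<^sup>2 / b * (q\<^sup>2) ^ j = A * q / b * q ^ (2 * j + 1)"
      unfolding q2 by (simp_all add: power2_eq_square)
    ultimately show "(1 - A * q\<^sup>2 / b * (q\<^sup>2) ^ j) * (1 - b * c * q * (q\<^sup>2) ^ j) =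
         1 + A * c * q ^ (4 * j + 3) - c * q ^ (2 * j + 1) * Y"
      unfolding Y_def using pair_denominator [OF assms(1,2), of A q "q ^ (2 * j + 1)"] by presburger
  qed simp
  show ?thesis unfolding alpha_gen_def qpochs_def 1 [symmetric] 2 [symmetric]
    by (simp add: mult_ac)
qed

text \<open>Each difference is factored by \<open>cpole_diff\<close> and \<open>xnode_diff\<close>
  at \<open>d = 1 / q ^ (2 * k)\<close>, the parameter that belongs to the node
  \<open>xnode q A k\<close>.\<close>

lemma lagr_inv_diag_nodes:
  fixes q A :: "'a::field"
  assumes "q \<noteq> 0"
  shows "lagr_inv (xnode q A) (cpole q A) k k = (\<Prod>j<k. q ^ j) *
    ((\<Prod>j<k. 1 - q ^ j / q ^ (2 * k)) / (\<Prod>j<k. 1 - q ^ (2 * j) / q ^ (2 * k))) *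
    ((\<Prod>j<k. 1 - A * q ^ (2 * k) * q ^ (j + 1)) / (\<Prod>j<k. 1 - A * q ^ (2 * k) * q ^ (2 * j + 1)))"
proof -
  let ?d = "1 / q ^ (2 * k)"
  have d: "?d \<noteq> 0" using assms by simp
  have 1: "(\<Prod>j<k. cpole q A j - xnode q A k) = (\<Prod>j<k. 1 / q ^ j) * (\<Prod>j<k. 1 - q ^ j / q ^ (2 * k)) *
    (\<Prod>j<k. 1 - A * q ^ (2 * k) * q ^ (j + 1))"
    unfolding prod.distrib [symmetric]
  proof (rule prod.cong)
    fix j
    have "q ^ j * (cpole q A j - xnode q A k) = (1 - ?d * q ^ j) * (1 - A * q / ?d * q ^ j)"
      unfolding xnode_alt [OF assms, of A k] by (rule cpole_diff [OF assms d])
    then show "cpole q A j - xnode q A k =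
      1 / q ^ j * (1 - q ^ j / q ^ (2 * k)) * (1 - A * q ^ (2 * k) * q ^ (j + 1))"
      using assms by (simp add: field_simps)
  qed simp
  have 2: "(\<Prod>j<k. xnode q A j - xnode q A k) = (\<Prod>j<k. (1 / q ^ j) * (1 / q ^ j)) * (\<Prod>j<k. 1 - q ^ (2 * j) / q ^ (2 * k)) *
    (\<Prod>j<k. 1 - A * q ^ (2 * k) * q ^ (2 * j + 1))"
    unfolding prod.distrib [symmetric]
  proof (rule prod.cong)
    fix j
    have "q ^ (2 * j) * (xnode q A j - xnode q A k) = (1 - ?d * q ^ (2 * j)) * (1 - A * q / ?d * q ^ (2 * j))"
      unfolding xnode_alt [OF assms, of A k] by (rule xnode_diff [OF assms d])
    then have "xnode q A j - xnode q A k =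
      (1 / q ^ (2 * j)) * (1 - q ^ (2 * j) / q ^ (2 * k)) * (1 - A * q ^ (2 * k) * q ^ (2 * j + 1))"
      using assms by (simp add: field_simps)
    moreover have "1 / q ^ (2 * j) = (1 / q ^ j) * (1 / q ^ j)"
      by (simp add: mult_2 power_add)
    ultimately show "xnode q A j - xnode q A k =
      1 / q ^ j * (1 / q ^ j) * (1 - q ^ (2 * j) / q ^ (2 * k)) * (1 - A * q ^ (2 * k) * q ^ (2 * j + 1))"
      by simp
  qed simp
  \<comment> \<open>The powers \<open>1 / q ^ j\<close> occur once above and twice below the
    fraction bar, which leaves the product of the \<open>q ^ j\<close>.\<close>
  have alg: "u * r * s / (u * u * r' * s') = v * (r / r') * (s / s')" if "u * v = 1"
    for u r s r' s' v :: 'a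
  proof -
    have "u \<noteq> 0" using that by auto
    then have "v = 1 / u" using that by (simp add: field_simps)
    with \<open>u \<noteq> 0\<close> show ?thesis by (simp add: mult_ac)
  qed
  have 3: "(\<Prod>j<k. 1 / q ^ j) * (\<Prod>j<k. q ^ j) = 1"
    unfolding prod.distrib [symmetric] using assms by simp
  show ?thesis unfolding lagr_inv_diag 1 2 prod.distrib [of "\<lambda>j. 1 / q ^ j"]
    by (rule alg [OF 3])
qed


text \<open>The cleared difference \<open>P\<close> has degree at most \<open>k\<close> in
  \<open>Y\<close> and vanishes at \<open>k + 1\<close> distinct points. The conditions on
  \<open>A\<close> and \<open>c\<close> keep these points distinct and the denominators at the
  even-indexed ones nonzero.\<close>

lemma alpha_gen_eq_sum_generic:
  fixes q A b c :: "'a::field"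
  assumes q: "q \<noteq> 0" and c0: "c \<noteq> 0" and b: "b \<noteq> 0" and A0: "A \<noteq> 0"
    and A: "\<And>i. A * q ^ i \<noteq> 1" "\<And>i. A * q ^ i \<noteq> c"
    and c: "\<And>i. c * q ^ i \<noteq> 1" "\<And>i. q ^ i \<noteq> c"
    and qi: "\<And>i. 0 < i \<Longrightarrow> i \<le> 2 * k \<Longrightarrow> q ^ i \<noteq> 1"
    and inj: "inj_on (xnode q A) {..k}"
    and V: "qpochs [A * q ^ 2 / b, b * c * q] (q ^ 2) k \<noteq> 0"
  shows "alpha_gen q A b c k = (\<Sum>m\<le>k. lagr_inv (xnode q A) (cpole q A) k m * beta_gen q A b c m)"
proof -
  define B where "B m = lagr_inv (xnode q A) (cpole q A) k m" for m
  define G where "G m = qpochhammer (A * q ^ 2) (q ^ 2) m * qpochhammer (c * q) (q ^ 2) m /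
    (qpochhammer q (q ^ 2) m * qpochhammer (A * q ^ 2 / c) (q ^ 2) m)" for m
  define K where "K = (1 - A * q ^ (3 * k)) / (1 - A) * (qpochhammer A (q ^ 2) k * qpochhammer c q k) /
    (qpochhammer q q k * qpochhammer (A * q ^ 2 / c) (q ^ 2) k) * q ^ k * (\<Prod>j<k. q ^ j)"
  define Uo where "Uo j = [:1 + A * q ^ (4 * j + 3) / c, - (q ^ (2 * j + 1)):]" for j
  define Ue where "Ue j = [:1 + A * q ^ (2 * j + 1) / c, - (q ^ j):]" for j
  define W where "W j = [:1 + A * c * q ^ (4 * j + 3), - (c * q ^ (2 * j + 1)):]" for j
  define Y where "Y b = b + A * q / (b * c)" for b
  have beta: "beta_gen q A b c m = G m * ((\<Prod>j<m. poly (Uo j) (Y b)) / (\<Prod>j<m. poly (W j) (Y b)))" if "b \<noteq> 0" for b m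
    unfolding G_def Uo_def W_def Y_def beta_gen_prod [OF that c0] by (simp add: mult_ac)
  have alpha: "alpha_gen q A b c k = K * ((\<Prod>j<k. poly (Ue j) (Y b)) / (\<Prod>j<k. poly (W j) (Y b)))" if "b \<noteq> 0" for b
    unfolding K_def Ue_def W_def Y_def alpha_gen_prod [OF that c0] by (simp add: mult_ac)
  have Uo: "poly (Uo j) (Y b) = (1 - b * q ^ (2 * j + 1)) * (1 - A * q / (b * c) * q ^ (2 * j + 1))" if "b \<noteq> 0" for b j
  proof -
    have "q ^ (4 * j + 3) = q * q ^ (2 * j + 1) * q ^ (2 * j + 1)" by (rule power_4_3)
    then show ?thesis unfolding Uo_def Y_def pair_numerator [OF that c0] by (simp add: algebra_simps)
  qed
  have Ue: "poly (Ue j) (Y b) = (1 - b * q ^ j) * (1 - A * q / (b * c) * q ^ j)" if "b \<noteq> 0" for b j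
  proof -
    have "q ^ (2 * j + 1) = q * q ^ j * q ^ j" by (simp add: mult_2 power_add)
    then show ?thesis unfolding Ue_def Y_def pair_numerator [OF that c0] by (simp add: algebra_simps)
  qed
  have W: "poly (W j) (Y b) = (1 - A * q / b * q ^ (2 * j + 1)) * (1 - b * c * q ^ (2 * j + 1))" if "b \<noteq> 0" for b j
  proof -
    have "q ^ (4 * j + 3) = q * q ^ (2 * j + 1) * q ^ (2 * j + 1)" by (rule power_4_3)
    then show ?thesis unfolding W_def Y_def pair_denominator [OF that c0] by (simp add: algebra_simps)
  qed
  \<comment> \<open>\<open>beta_gen\<close> for \<open>m\<close> uses only the first
    \<open>m\<close> of the \<open>k\<close> common denominators; the others remain as the factors
    \<open>W j\<close> with \<open>m \<le> j\<close>.\<close>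
  define P where "P = (\<Sum>m\<le>k. smult (B m * G m) ((\<Prod>j<m. Uo j) * (\<Prod>j=m..<k. W j))) - smult K (\<Prod>j<k. Ue j)"
  have clear: "(\<Prod>j<k. poly (W j) (Y b)) * ((\<Sum>m\<le>k. B m * beta_gen q A b c m) - alpha_gen q A b c k) = poly P (Y b)"
    if b: "b \<noteq> 0" and ne: "(\<Prod>j<k. poly (W j) (Y b)) \<noteq> 0" for b
  proof -
    have "(\<Prod>j<k. poly (W j) (Y b)) * (B m * beta_gen q A b c m)
      = B m * G m * ((\<Prod>j<m. poly (Uo j) (Y b)) * (\<Prod>j=m..<k. poly (W j) (Y b)))" if "m \<le> k" for m
    proof -
      have "(\<Prod>j<k. poly (W j) (Y b)) = (\<Prod>j<m. poly (W j) (Y b)) * (\<Prod>j=m..<k. poly (W j) (Y b))"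
        using that prod.atLeastLessThan_concat [of 0 m k "\<lambda>j. poly (W j) (Y b)"] by (simp add: atLeast0LessThan)
      moreover have "(\<Prod>j<m. poly (W j) (Y b)) \<noteq> 0" using ne calculation by auto
      ultimately show ?thesis unfolding beta [OF b] by simp
    qed
    then have "(\<Prod>j<k. poly (W j) (Y b)) * (\<Sum>m\<le>k. B m * beta_gen q A b c m) =
      (\<Sum>m\<le>k. B m * G m * ((\<Prod>j<m. poly (Uo j) (Y b)) * (\<Prod>j=m..<k. poly (W j) (Y b))))"
      unfolding sum_distrib_left by (intro sum.cong) auto
    moreover have "(\<Prod>j<k. poly (W j) (Y b)) * alpha_gen q A b c k = K * (\<Prod>j<k. poly (Ue j) (Y b))"
      unfolding alpha [OF b] using ne by simp
    ultimately show ?thesis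
      by (simp add: P_def right_diff_distrib poly_sum poly_prod)
  qed
  have Aq: "A * q ^ i * q ^ j \<noteq> 1" for i j using A(1) [of "i + j"] by (simp add: power_add mult.assoc)
  have cq: "c * q ^ i / q ^ j \<noteq> 1" for i j
    by (rule mult_power_div_power_ne_1 [OF q c])
  have root: "poly P (Y (1 / q ^ i)) = 0" if i: "i < k" for i
  proof (cases "even i")
    case False
    then obtain s where s: "i = 2 * s + 1" by (auto elim: oddE)
    \<comment> \<open>For odd \<open>i\<close> every summand vanishes by itself: for
      \<open>m \<le> s\<close> the coefficient \<open>B m\<close> contains the pole of index
      \<open>2 * m\<close>, which equals the node of index \<open>m\<close>, and for
      \<open>m > s\<close> the factor \<open>1 - b * q ^ (2 * s + 1)\<close> of \<open>Uo s\<close>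
      is zero.\<close>
    have "B m * (\<Prod>j<m. poly (Uo j) (Y (1 / q ^ i))) = 0" if m: "m \<le> k" for m
    proof (cases "m \<le> s")
      case True
      then have "2 * m < k - 1" using i s by simp
      then have "(\<Prod>j<k - 1. cpole q A j - xnode q A m) = 0"
        using cpole_even [of q A m] by (intro prod_zero) (auto intro!: bexI [of _ "2 * m"])
      then show ?thesis using i by (simp add: B_def lagr_inv_def)
    next
      case False
      have "poly (Uo s) (Y (1 / q ^ i)) = 0" using q s by (subst Uo) auto
      then have "(\<Prod>j<m. poly (Uo j) (Y (1 / q ^ i))) = 0" using False by (intro prod_zero) auto
      then show ?thesis by simp
    qed
    then have "(\<Sum>m\<le>k. B m * G m * ((\<Prod>j<m. poly (Uo j) (Y (1 / q ^ i))) * (\<Prod>j=m..<k. poly (W j) (Y (1 / q ^ i))))) = 0"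
      by (intro sum.neutral) auto
    moreover have "(\<Prod>j<k. poly (Ue j) (Y (1 / q ^ i))) = 0"
      using i q by (intro prod_zero) (auto simp: Ue intro!: bexI [of _ i])
    ultimately show ?thesis by (simp add: P_def poly_sum poly_prod)
  next
    case True
    then obtain s where s: "i = 2 * s" by (auto elim: evenE)
    have n: "1 / q ^ i \<noteq> 0" using q by simp
    have "poly (W j) (Y (1 / q ^ i)) \<noteq> 0" for j
      unfolding W [OF n] using Aq [of "Suc i" "2 * j + 1"] cq [of "2 * j + 1" i]
      by (simp add: mult_ac)
    then have W0: "(\<Prod>j<k. poly (W j) (Y (1 / q ^ i))) \<noteq> 0" by simp
    have "(\<Sum>m\<le>k. B m * beta_gen q A (1 / q ^ i) c m) = 0"
      unfolding B_def s by (rule lagrange_beta_even [OF q c0 A c qi _ inj]) (use i s in auto)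
    moreover have "alpha_gen q A (1 / q ^ i) c k = 0"
    proof -
      have "(\<Prod>j<k. poly (Ue j) (Y (1 / q ^ i))) = 0"
        using i q by (intro prod_zero) (auto simp: Ue intro!: bexI [of _ i])
      then show ?thesis unfolding alpha [OF n] by simp
    qed
    ultimately show ?thesis using clear [OF n W0] by simp
  qed
  have pochA: "qpochhammer (A * q ^ 2 / c) (q ^ 2) k \<noteq> 0"
  proof -
    have "A * q ^ 2 / c * (q ^ 2) ^ j \<noteq> 1" for j
    proof -
      have "A * q ^ 2 / c * (q ^ 2) ^ j = A * q ^ (2 + 2 * j) / c"
        unfolding power_mult [symmetric] by (simp add: power_add power2_eq_square)
      then show ?thesis using A(2) [of "2 + 2 * j"] c0 by auto
    qed
    then show ?thesis by (auto simp: qpochhammer_eq_0_iff)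
  qed
  have pq: "qpochhammer q q (2 * k) \<noteq> 0"
    using qi by (auto simp: qpochhammer_eq_0_iff simp flip: power_Suc)
  have R2: "(\<Prod>j<k. 1 - q ^ (2 * j) / q ^ (2 * k)) \<noteq> 0"
  proof -
    have "q ^ (2 * j) \<noteq> q ^ (2 * k)" if "j < k" for j
    proof
      assume e: "q ^ (2 * j) = q ^ (2 * k)"
      have "q ^ (2 * k - 2 * j) = 1" using e q that by (intro power_diff_eq_1) auto
      then show False using qi [of "2 * k - 2 * j"] that by auto
    qed
    then show ?thesis using q by auto
  qed
  have rootA: "poly P (Y (A * q ^ (2 * k))) = 0"
  proof -
    define y where "y = Y (A * q ^ (2 * k))"
    have n: "A * q ^ (2 * k) \<noteq> 0" using A0 q by simp
    \<comment> \<open>At \<open>b = A * q ^ (2 * k)\<close> the last denominator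
      \<open>W (k - 1)\<close> is zero, so only the summand with \<open>m = k\<close>, which does
      not contain it, survives.\<close>
    have "(\<Prod>j=m..<k. poly (W j) y) = 0" if "m < k" for m
    proof (rule prod_zero)
      have "poly (W (k - 1)) y = 0"
      proof -
        have "q * q ^ (2 * (k - 1) + 1) = q ^ (2 * k)" using that
          by (cases k) simp_all
        then have "A * q / (A * q ^ (2 * k)) * q ^ (2 * (k - 1) + 1) = 1" using q A0
          by (simp add: field_simps)
        then show ?thesis unfolding y_def W [OF n] by simp
      qed
      then show "\<exists>j\<in>{m..<k}. poly (W j) y = 0" using that by (intro bexI [of _ "k - 1"]) auto
    qed simp
    then have "(\<Sum>m\<le>k. B m * G m * ((\<Prod>j<m. poly (Uo j) y) * (\<Prod>j=m..<k. poly (W j) y)))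
       = (\<Sum>m\<in>{k}. B m * G m * ((\<Prod>j<m. poly (Uo j) y) * (\<Prod>j=m..<k. poly (W j) y)))"
      by (intro sum.mono_neutral_right) auto
    then have "poly P y = B k * G k * (\<Prod>j<k. poly (Uo j) y) - K * (\<Prod>j<k. poly (Ue j) y)"
      by (simp add: P_def poly_sum poly_prod)
    moreover have "B k * G k * (\<Prod>j<k. poly (Uo j) y) = K * (\<Prod>j<k. poly (Ue j) y)"
    proof -
      define Q where "Q = q ^ (2 * k)"
      have Q0: "Q \<noteq> 0" using q by (simp add: Q_def)
      have y: "y = Y (A * Q)" and nQ: "A * Q \<noteq> 0" using A0 Q0 by (simp_all add: y_def Q_def)
      have uo: "(\<Prod>j<k. poly (Uo j) y) = (\<Prod>j<k. 1 - A * Q * q ^ (2 * j + 1)) * (\<Prod>j<k. 1 - q ^ (2 * j + 2) / (c * Q))"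
        unfolding y Uo [OF nQ] prod.distrib [symmetric]
        by (intro prod.cong refl arg_cong2 [where f = "(*)"] arg_cong2 [where f = "(-)"])
          (use A0 Q0 c0 in \<open>simp_all add: field_simps\<close>)
      have ue: "(\<Prod>j<k. poly (Ue j) y) = (\<Prod>j<k. 1 - A * Q * q ^ j) * (\<Prod>j<k. 1 - q ^ (j + 1) / (c * Q))"
        unfolding y Ue [OF nQ] prod.distrib [symmetric]
        by (intro prod.cong refl arg_cong2 [where f = "(*)"] arg_cong2 [where f = "(-)"])
          (use A0 Q0 c0 in \<open>simp_all add: field_simps\<close>)
      have bk: "B k = (\<Prod>j<k. q ^ j) * ((\<Prod>j<k. 1 - q ^ j / Q) / (\<Prod>j<k. 1 - q ^ (2 * j) / Q)) *
          ((\<Prod>j<k. 1 - A * Q * q ^ (j + 1)) / (\<Prod>j<k. 1 - A * Q * q ^ (2 * j + 1)))"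
        unfolding B_def Q_def by (rule lagr_inv_diag_nodes [OF q])
      have rq: "(\<Prod>j<k. 1 - q ^ j / Q) / (\<Prod>j<k. 1 - q ^ (2 * j) / Q) *
          (\<Prod>j<k. 1 - q ^ (2 * j + 2) / (c * Q)) * (qpochhammer (c * q) (q ^ 2) k / qpochhammer q (q ^ 2) k) =
          (\<Prod>j<k. 1 - q ^ (j + 1) / (c * Q)) * (qpochhammer c q k / qpochhammer q q k) * q ^ k"
        unfolding Q_def by (rule reflect_quotient [OF q c0 pq R2])
      have AQ: "A * Q * q ^ i \<noteq> 1" "A * Q \<noteq> 1" for i using Aq [of "2 * k" i] Aq [of "2 * k" 0] by (simp_all add: Q_def)
      have nz: "(\<Prod>j<k. 1 - A * Q * q ^ (2 * j + 1)) \<noteq> 0" using AQ by (simp del: power_Suc)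
      \<comment> \<open>Both sides are the symbol with parameter \<open>A * Q\<close> of length
        \<open>k + 1\<close>, with the first or the last factor split off. The last one is the
        very-well-poised factor \<open>1 - A * q ^ (3 * k)\<close> of
        \<open>alpha_gen\<close>.\<close>
      have sh1: "(1 - A * Q) * (\<Prod>j<k. 1 - A * Q * q ^ (j + 1)) = (\<Prod>j<k. 1 - A * Q * q ^ j) * (1 - A * q ^ (3 * k))"
      proof -
        have "q ^ (3 * k) = Q * q ^ k" by (simp add: Q_def flip: power_add)
        moreover have "(\<Prod>j<Suc k. 1 - A * Q * q ^ j) = (1 - A * Q) * (\<Prod>j<k. 1 - A * Q * q ^ (j + 1))"
          by (subst prod.lessThan_Suc_shift) simp
        ultimately show ?thesis by (simp add: mult.assoc)
      qed
      have sh2: "(1 - A) * qpochhammer (A * q ^ 2) (q ^ 2) k = qpochhammer A (q ^ 2) k * (1 - A * Q)"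
        using qpochhammer_add [of A "q ^ 2" 1 k] qpochhammer_add [of A "q ^ 2" k 1]
        by (simp add: Q_def power_mult add.commute)
      have A1: "1 - A \<noteq> 0" using A(1) [of 0] by simp
      have AQ1: "1 - A * Q \<noteq> 0" using AQ(2) by simp
      have alg: "p * (r1 / r2) * (s / t) * (ap * cq / (qq * d)) * (t * r3) = (x / a1) * (aq * ck) / (qk * d) * w * p * (u * r4)"
        if "r1 / r2 * r3 * (cq / qq) = r4 * (ck / qk) * w" "h * s = u * x" "a1 * ap = aq * h"
          "t \<noteq> 0" "a1 \<noteq> 0" "h \<noteq> 0"
        for p r1 r2 s t ap cq qq d r3 x a1 aq ck qk w u r4 h :: 'a
      proof -
        have 1: "s * ap = x / a1 * aq * u"
        proof -
          have "(h * s) * (a1 * ap) = (u * x) * (aq * h)" using that by simp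
          then have "s * a1 * ap = u * x * aq" using \<open>h \<noteq> 0\<close> by (simp add: mult_ac)
          then show ?thesis using \<open>a1 \<noteq> 0\<close> by (simp add: field_simps)
        qed
        have "p * (r1 / r2) * (s / t) * (ap * cq / (qq * d)) * (t * r3)
          = p * (s * ap) * (r1 / r2 * r3 * (cq / qq)) / d"
          using \<open>t \<noteq> 0\<close> by (simp add: mult_ac)
        also have "\<dots> = (x / a1) * (aq * ck) / (qk * d) * w * p * (u * r4)"
          unfolding 1 that(1) by (simp add: mult_ac)
        finally show ?thesis .
      qed
      show ?thesis unfolding uo ue bk G_def K_def
        by (rule alg [OF rq sh1 sh2 nz A1 AQ1])
    qed
    ultimately show ?thesis by (simp add: y_def)
  qed
  have "degree P \<le> k"
  proof -
    have "degree (Uo j) \<le> 1" "degree (Ue j) \<le> 1" "degree (W j) \<le> 1" for j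
      by (simp_all add: Uo_def Ue_def W_def)
    then have d: "degree (\<Prod>j\<in>S. Uo j) \<le> card S" "degree (\<Prod>j\<in>S. Ue j) \<le> card S"
      "degree (\<Prod>j\<in>S. W j) \<le> card S" if "finite S" for S :: "nat set"
      using that by (auto intro!: order.trans [OF degree_prod_sum_le] order.trans [OF sum_bounded_above [of S _ 1]])
    have "degree ((\<Prod>j<m. Uo j) * (\<Prod>j=m..<k. W j)) \<le> k" if "m \<le> k" for m
      using d(1) [of "{..<m}"] d(3) [of "{m..<k}"] that
      by (intro order.trans [OF degree_mult_le]) simp
    moreover have "degree (\<Prod>j<k. Ue j) \<le> k" using d(2) [of "{..<k}"] by simp
    ultimately show ?thesis unfolding P_def
      by (intro degree_diff_le degree_sum_le) (auto intro: order.trans [OF degree_smult_le])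
  qed
  define S where "S = insert (Y (A * q ^ (2 * k))) ((\<lambda>i. Y (1 / q ^ i)) ` {..<k})"
  \<comment> \<open>For a given value of \<open>Y\<close> the equation for \<open>b\<close> is
    quadratic, and its two solutions have product \<open>A * q / c\<close>.\<close>
  have Yeq: "u = v \<or> A * q = u * v * c" if "Y u = Y v" "u \<noteq> 0" "v \<noteq> 0" for u v
  proof -
    have "(u - v) * (u * v * c - A * q) = u * v * c * (Y u - Y v)"
      unfolding Y_def using that c0 by (simp add: field_simps)
    then show ?thesis using that by auto
  qed
  have injY: "inj_on (\<lambda>i. Y (1 / q ^ i)) {..<k}"
  proof (rule inj_onI)
    fix i j assume ij: "i \<in> {..<k}" "j \<in> {..<k}" and e: "Y (1 / q ^ i) = Y (1 / q ^ j)"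
    have "A * q \<noteq> 1 / q ^ i * (1 / q ^ j) * c"
      using A(2) [of "Suc (i + j)"] q by (simp add: field_simps power_add)
    then have "q ^ i = q ^ j" using Yeq [OF e] q by auto
    moreover have "q ^ i \<noteq> q ^ j" if "i < j" "j < k" for i j
    proof
      assume "q ^ i = q ^ j"
      then have "q ^ (j - i) = 1" using q that by (intro power_diff_eq_1) auto
      then show False using qi [of "j - i"] that by auto
    qed
    ultimately show "i = j" using ij by (metis lessThan_iff linorder_neqE_nat)
  qed
  have notin: "Y (A * q ^ (2 * k)) \<notin> (\<lambda>i. Y (1 / q ^ i)) ` {..<k}"
  proof
    assume "Y (A * q ^ (2 * k)) \<in> (\<lambda>i. Y (1 / q ^ i)) ` {..<k}"
    then obtain i where i: "i < k" "Y (A * q ^ (2 * k)) = Y (1 / q ^ i)" by auto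
    have "A * q ^ (2 * k) \<noteq> 1 / q ^ i" using Aq [of "2 * k" i] q by (simp add: field_simps)
    moreover have "A * q \<noteq> A * q ^ (2 * k) * (1 / q ^ i) * c"
      using cq [of "2 * k" "Suc i"] A0 q by (auto simp: field_simps)
    ultimately show False using Yeq [OF i(2)] A0 q by auto
  qed
  have "card S = Suc k" unfolding S_def using injY notin by (simp add: card_image)
  have P0: "P = 0"
  proof (rule ccontr)
    assume "P \<noteq> 0"
    have "card S \<le> card {y. poly P y = 0}"
      using root rootA unfolding S_def by (intro card_mono poly_roots_finite \<open>P \<noteq> 0\<close>) auto
    also have "\<dots> \<le> degree P" using \<open>P \<noteq> 0\<close> by (rule card_poly_roots_bound)
    finally show False using \<open>degree P \<le> k\<close> \<open>card S = Suc k\<close> by simp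
  qed
  have W0: "(\<Prod>j<k. poly (W j) (Y b)) \<noteq> 0"
  proof -
    have "(\<Prod>j<k. poly (W j) (Y b)) = qpochs [A * q ^ 2 / b, b * c * q] (q ^ 2) k"
      unfolding W [OF b] prod.distrib qpochs_def qpochhammer_def
      by (simp add: power_mult power2_eq_square power_mult_distrib mult_ac)
    then show ?thesis using V by simp
  qed
  show ?thesis using clear [OF b W0] W0 unfolding P0 B_def by simp
qed

section \<open>Places of a fraction field\<close>

text \<open>A ring homomorphism into a field has a prime kernel and extends to the localisation
  there. The relation \<open>spec\<close> is the graph of this extension, so values can be computed
  without choosing a numerator and a denominator.\<close>

locale fract_place =
  fixes h :: "'r::idom \<Rightarrow> 'k::field"
  assumes h_0 [simp]: "h 0 = 0" and h_1 [simp]: "h 1 = 1"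
    and h_add [simp]: "h (x + y) = h x + h y" and h_mult [simp]: "h (x * y) = h x * h y"
begin

text \<open>\<open>spec x y\<close>: the fraction \<open>x\<close> is regular at the place \<open>h\<close> and takes the value \<open>y\<close> there.\<close>

definition spec :: "'r fract \<Rightarrow> 'k \<Rightarrow> bool" where
  "spec x y \<longleftrightarrow> (\<exists>u v. h v \<noteq> 0 \<and> x = to_fract u / to_fract v \<and> y = h u / h v)"

lemma h_uminus [simp]: "h (- x) = - h x"
  using h_add [of x "- x"] by (simp add: eq_neg_iff_add_eq_0 add.commute)

lemma h_nz: "h v \<noteq> 0 \<Longrightarrow> to_fract v \<noteq> 0"
  by auto

lemma spec_to_fract: "spec (to_fract u) (h u)"
  unfolding spec_def by (intro exI [of _ u] exI [of _ 1]) auto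

lemma spec_to_fract': "h u = y \<Longrightarrow> spec (to_fract u) y"
  using spec_to_fract by blast

lemma spec_0: "spec 0 0" and spec_1: "spec 1 1"
  using spec_to_fract [of 0] spec_to_fract [of 1] by simp_all

lemma spec_add: "spec x y \<Longrightarrow> spec x' y' \<Longrightarrow> spec (x + x') (y + y')"
  unfolding spec_def
proof (elim exE conjE)
  fix u v u' v'
  assume *: "h v \<noteq> 0" "x = to_fract u / to_fract v" "y = h u / h v"
    "h v' \<noteq> 0" "x' = to_fract u' / to_fract v'" "y' = h u' / h v'"
  then show "\<exists>u v. h v \<noteq> 0 \<and> x + x' = to_fract u / to_fract v \<and> y + y' = h u / h v"
    using h_nz [of v] h_nz [of v']
    by (intro exI [of _ "u * v' + u' * v"] exI [of _ "v * v'"]) (simp add: add_frac_eq)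
qed

lemma spec_mult: "spec x y \<Longrightarrow> spec x' y' \<Longrightarrow> spec (x * x') (y * y')"
  unfolding spec_def
proof (elim exE conjE)
  fix u v u' v'
  assume *: "h v \<noteq> 0" "x = to_fract u / to_fract v" "y = h u / h v"
    "h v' \<noteq> 0" "x' = to_fract u' / to_fract v'" "y' = h u' / h v'"
  then show "\<exists>u v. h v \<noteq> 0 \<and> x * x' = to_fract u / to_fract v \<and> y * y' = h u / h v"
    by (intro exI [of _ "u * u'"] exI [of _ "v * v'"]) simp
qed

lemma spec_uminus: "spec x y \<Longrightarrow> spec (- x) (- y)"
  using spec_mult [OF spec_to_fract [of "- 1"], of x y] by simp

lemma spec_diff: "spec x y \<Longrightarrow> spec x' y' \<Longrightarrow> spec (x - x') (y - y')"
  using spec_add [OF _ spec_uminus, of x y x' y'] by simp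

text \<open>Transports identities: two equal fractions that are regular at the place have equal
  values.\<close>

lemma spec_unique:
  assumes "spec x y" "spec x y'"
  shows "y = y'"
proof -
  obtain u v u' v' where *: "h v \<noteq> 0" "x = to_fract u / to_fract v" "y = h u / h v"
    "h v' \<noteq> 0" "x = to_fract u' / to_fract v'" "y' = h u' / h v'"
    using assms unfolding spec_def by blast
  then have "to_fract (u * v') = to_fract (u' * v)"
    using h_nz [of v] h_nz [of v'] by (simp add: frac_eq_eq)
  then have "h (u * v') = h (u' * v)" by (metis to_fract_eq_iff)
  then show ?thesis using * by (simp add: frac_eq_eq)
qed

lemma spec_nonzero: "spec x y \<Longrightarrow> y \<noteq> 0 \<Longrightarrow> x \<noteq> 0"
  using spec_unique [OF spec_0] by blast

lemma spec_inverse: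
  assumes "spec x y" "y \<noteq> 0"
  shows "spec (inverse x) (inverse y)"
proof -
  obtain u v where *: "h v \<noteq> 0" "x = to_fract u / to_fract v" "y = h u / h v"
    using assms unfolding spec_def by blast
  then show ?thesis using assms(2) unfolding spec_def
    by (intro exI [of _ v] exI [of _ u]) auto
qed

lemma spec_divide: "spec x y \<Longrightarrow> spec x' y' \<Longrightarrow> y' \<noteq> 0 \<Longrightarrow> spec (x / x') (y / y')"
  unfolding divide_inverse by (intro spec_mult spec_inverse)

lemma spec_power: "spec x y \<Longrightarrow> spec (x ^ n) (y ^ n)"
  by (induction n) (auto intro: spec_1 spec_mult)

lemma spec_sum: "(\<And>i. i \<in> S \<Longrightarrow> spec (f i) (g i)) \<Longrightarrow> spec (sum f S) (sum g S)"
  by (induction S rule: infinite_finite_induct) (auto intro: spec_0 spec_add)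

lemma spec_prod: "(\<And>i. i \<in> S \<Longrightarrow> spec (f i) (g i)) \<Longrightarrow> spec (prod f S) (prod g S)"
  by (induction S rule: infinite_finite_induct) (auto intro: spec_1 spec_mult)

lemmas spec_arith = spec_0 spec_1 spec_add spec_mult spec_uminus spec_diff spec_power

lemma spec_qpochhammer: "spec x y \<Longrightarrow> spec p p' \<Longrightarrow> spec (qpochhammer x p k) (qpochhammer y p' k)"
  unfolding qpochhammer_def by (intro spec_prod spec_arith)

lemma spec_qpochs: "list_all2 spec xs ys \<Longrightarrow> spec p p' \<Longrightarrow> spec (qpochs xs p k) (qpochs ys p' k)"
  by (induction rule: list_all2_induct) (auto simp: qpochs_def intro: spec_1 spec_mult spec_qpochhammer)

lemma spec_qint: "spec p p' \<Longrightarrow> spec (qint p k) (qint p' k)"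
  unfolding qint_def by (intro spec_sum spec_arith)

lemma spec_xnode: "spec q q' \<Longrightarrow> spec A A' \<Longrightarrow> q' \<noteq> 0 \<Longrightarrow> spec (xnode q A j) (xnode q' A' j)"
  unfolding xnode_def by (intro spec_arith spec_divide) auto

lemma spec_cpole: "spec q q' \<Longrightarrow> spec A A' \<Longrightarrow> q' \<noteq> 0 \<Longrightarrow> spec (cpole q A j) (cpole q' A' j)"
  unfolding cpole_def by (intro spec_arith spec_divide) auto

lemma spec_lagr_inv:
  assumes "\<And>j. spec (x j) (x' j)" "\<And>j. spec (c j) (c' j)" "inj_on x' {..k}" "m \<le> k"
  shows "spec (lagr_inv x c k m) (lagr_inv x' c' k m)"
proof -
  have "(\<Prod>j\<in>{..k} - {m}. x' j - x' m) \<noteq> 0"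
    using assms(3,4) by (auto simp: inj_on_def)
  then show ?thesis unfolding lagr_inv_def using assms(1,2)
    by (auto intro!: spec_arith spec_divide spec_prod)
qed

lemma spec_beta_gen:
  assumes "spec q q'" "spec A A'" "spec b b'" "spec c c'" "b' \<noteq> 0" "c' \<noteq> 0"
    "qpochs [q', A' * q' ^ 2 / b', A' * q' ^ 2 / c', b' * c' * q'] (q' ^ 2) m \<noteq> 0"
  shows "spec (beta_gen q A b c m) (beta_gen q' A' b' c' m)"
  unfolding beta_gen_def using assms
  by (intro spec_divide spec_qpochs) (auto intro!: spec_arith spec_divide)

lemma spec_alpha_gen:
  assumes "spec q q'" "spec A A'" "spec b b'" "spec c c'" "b' \<noteq> 0" "c' \<noteq> 0" "A' \<noteq> 1"
    "qpochhammer q' q' k \<noteq> 0"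
    "qpochs [A' * q' ^ 2 / b', A' * q' ^ 2 / c', b' * c' * q'] (q' ^ 2) k \<noteq> 0"
  shows "spec (alpha_gen q A b c k) (alpha_gen q' A' b' c' k)"
  unfolding alpha_gen_def using assms
  by (intro spec_arith spec_divide spec_qpochs spec_qpochhammer spec_prod) (auto intro!: spec_arith spec_divide)

end

text \<open>If \<open>r / s = u / v\<close> with \<open>h u = 0\<close> and
  \<open>h v \<noteq> 0\<close>, then \<open>r * v = u * s\<close> forces \<open>h r = 0\<close>.
  This leads from a vanishing value to the reduced numerator in \<open>fract_cong\<close>.\<close>

lemma numerator_place_eq_0:
  fixes h :: "'r :: {ring_gcd, idom_divide, semiring_gcd_mult_normalize} \<Rightarrow> 'k::field"
  assumes "fract_place h" "fract_place.spec h x 0"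
  shows "h (fst (quot_of_fract x)) = 0"
proof -
  interpret fract_place h by fact
  obtain u v where *: "h v \<noteq> 0" "x = to_fract u / to_fract v" "0 = h u / h v"
    using assms(2) unfolding spec_def by blast
  define r s where "r = fst (quot_of_fract x)" and "s = snd (quot_of_fract x)"
  have "to_fract r / to_fract s = x"
    unfolding r_def s_def by (metis Fract_conv_to_fract Fract_quot_of_fract)
  moreover have "s \<noteq> 0" by (simp add: s_def)
  ultimately have "to_fract (r * v) = to_fract (u * s)"
    using * h_nz [of v] by (simp add: frac_eq_eq)
  then have "h (r * v) = h (u * s)" by (metis to_fract_eq_iff)
  then show ?thesis using * by (simp add: r_def)
qed

lemma fract_place_poly: "fract_place (\<lambda>p. poly p (x :: 'k::field))"
  by unfold_locales auto

text \<open>The interpolation proof needs \<open>A\<close> transcendental over \<open>q\<close> to keep its nodes distinct;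
  specialising the indeterminate of \<^typ>\<open>'k poly\<close> then allows \<open>A\<close> to be a root of unity.\<close>

lemma alpha_gen_eq_sum:
  fixes q A b c :: "'k::field"
  assumes q: "q \<noteq> 0" and c0: "c \<noteq> 0" and b: "b \<noteq> 0" and A1: "A \<noteq> 1"
    and c: "\<And>i. c * q ^ i \<noteq> 1" "\<And>i. q ^ i \<noteq> c"
    and qi: "\<And>i. 0 < i \<Longrightarrow> i \<le> 2 * k \<Longrightarrow> q ^ i \<noteq> 1"
    and inj: "inj_on (xnode q A) {..k}"
    and den: "qpochs [A * q ^ 2 / b, A * q ^ 2 / c, b * c * q] (q ^ 2) k \<noteq> 0"
  shows "alpha_gen q A b c k = (\<Sum>m\<le>k. lagr_inv (xnode q A) (cpole q A) k m * beta_gen q A b c m)"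
proof -
  interpret fract_place "\<lambda>p. poly p A" by (rule fract_place_poly)
  \<comment> \<open>\<open>T\<close> embeds the constants, and \<open>AA\<close> is an indeterminate
    over them whose value at the place is \<open>A\<close>.\<close>
  define T where "T u = to_fract [:u:]" for u :: 'k
  define AA where "AA = to_fract [:0, 1 :: 'k:]"
  have T [intro]: "spec (T u) u" for u unfolding T_def by (rule spec_to_fract') simp
  have AA [intro]: "spec AA A" unfolding AA_def by (rule spec_to_fract') simp
  have Tm: "T u * T v = T (u * v)" "T u ^ i = T (u ^ i)" "T 1 = 1" "T u = T v \<longleftrightarrow> u = v" "T 0 = 0" for u v i
  proof -
    show Tm: "T u * T v = T (u * v)" for u v by (simp add: T_def mult.commute flip: to_fract_mult)
    show T1: "T 1 = 1" by (simp add: T_def flip: one_pCons)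
    show "T u ^ i = T (u ^ i)" by (induction i) (simp_all add: T1 Tm)
  qed (simp_all add: T_def)
  have AT: "AA * T u \<noteq> T v" if "u \<noteq> 0" for u v
    using that by (simp add: AA_def T_def flip: to_fract_mult)
  have pn: "qpochhammer q (q ^ 2) m \<noteq> 0" if "m \<le> k" for m
    using qi that by (auto simp: qpochhammer_eq_0_iff simp flip: power_mult power_Suc)
  have pn': "qpochhammer q q k \<noteq> 0"
    using qi by (auto simp: qpochhammer_eq_0_iff simp flip: power_Suc)
  have den': "qpochs [q, A * q ^ 2 / b, A * q ^ 2 / c, b * c * q] (q ^ 2) m \<noteq> 0" if "m \<le> k" for m
    using den pn [OF that] that
    by (auto simp: qpochs_def qpochhammer_eq_0_iff)
  have "alpha_gen (T q) AA (T b) (T c) k =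
    (\<Sum>m\<le>k. lagr_inv (xnode (T q) AA) (cpole (T q) AA) k m * beta_gen (T q) AA (T b) (T c) m)"
  proof (rule alpha_gen_eq_sum_generic)
    show "T q \<noteq> 0" "T c \<noteq> 0" "T b \<noteq> 0" using q b c0 Tm(4) [of _ 0] by (auto simp: Tm)
    show "AA \<noteq> 0" by (simp add: AA_def)
    show "AA * T q ^ i \<noteq> 1" "AA * T q ^ i \<noteq> T c" for i
      using AT [of "q ^ i" 1] AT [of "q ^ i" c] q by (simp_all add: Tm)
    show "T c * T q ^ i \<noteq> 1" "T q ^ i \<noteq> T c" for i
      using c Tm(4) [of _ 1] by (simp_all add: Tm)
    show "T q ^ i \<noteq> 1" if "0 < i" "i \<le> 2 * k" for i
      using qi [OF that] Tm(4) [of _ 1] by (simp add: Tm)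
    \<comment> \<open>The generic nodes differ because their values at the place differ.\<close>
    show "inj_on (xnode (T q) AA) {..k}"
    proof (rule inj_onI, rule ccontr)
      fix i j assume ij: "i \<in> {..k}" "j \<in> {..k}" "xnode (T q) AA i = xnode (T q) AA j" "i \<noteq> j"
      have "spec (xnode (T q) AA i - xnode (T q) AA j) (xnode q A i - xnode q A j)"
        using q by (intro spec_diff spec_xnode) auto
      moreover have "xnode q A i - xnode q A j \<noteq> 0" using inj ij by (auto simp: inj_on_def)
      ultimately show False using spec_nonzero ij by fastforce
    qed
    have "spec (qpochs [AA * T q ^ 2 / T b, T b * T c * T q] (T q ^ 2) k) (qpochs [A * q ^ 2 / b, b * c * q] (q ^ 2) k)"
      using b c0 by (intro spec_qpochs) (auto intro!: spec_arith spec_divide)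
    then show "qpochs [AA * (T q)\<^sup>2 / T b, T b * T c * T q] ((T q)\<^sup>2) k \<noteq> 0"
      by (rule spec_nonzero) (use den in \<open>auto simp: qpochs_def\<close>)
  qed
  moreover have "spec (alpha_gen (T q) AA (T b) (T c) k) (alpha_gen q A b c k)"
    by (intro spec_alpha_gen T AA b c0 A1 pn' den)
  moreover have "spec (\<Sum>m\<le>k. lagr_inv (xnode (T q) AA) (cpole (T q) AA) k m * beta_gen (T q) AA (T b) (T c) m)
    (\<Sum>m\<le>k. lagr_inv (xnode q A) (cpole q A) k m * beta_gen q A b c m)"
    by (intro spec_sum spec_mult spec_lagr_inv spec_xnode spec_cpole spec_beta_gen T AA b c0 q inj den') auto
  ultimately show ?thesis by (metis spec_unique)
qed

section \<open>The two evaluations of the sum\<close>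

text \<open>For \<open>q \<noteq> 0\<close> this says that \<open>x\<close> is nonzero and not an
  integer power of \<open>q\<close>, expressed without negative exponents.\<close>

definition generic_wrt :: "'a::field \<Rightarrow> 'a \<Rightarrow> bool" where
  "generic_wrt q x \<longleftrightarrow> x \<noteq> 0 \<and> (\<forall>i. x * q ^ i \<noteq> 1) \<and> (\<forall>i. q ^ i \<noteq> x)"

lemma generic_denominators:
  assumes "generic_wrt q b" "generic_wrt q c" "generic_wrt q (b * c)"
  shows "qpochs [b * q ^ 2, c * q ^ 2, q ^ 3 / (b * c)] (q ^ 2) k \<noteq> 0"
proof -
  have p: "q ^ 2 * (q ^ 2) ^ j = q ^ (2 * j + 2)" "q ^ 3 * (q ^ 2) ^ j = q ^ (2 * j + 3)" for j
    unfolding power_mult [symmetric] power_add [symmetric] by (simp_all add: add.commute)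
  have "x * q ^ 2 * (q ^ 2) ^ j \<noteq> 1" if "generic_wrt q x" for x j
    using that p(1) [of j] by (metis generic_wrt_def mult.assoc)
  moreover have "q ^ 3 / (b * c) * (q ^ 2) ^ j \<noteq> 1" for j
    using assms(3) p(2) [of j] by (auto simp: generic_wrt_def)
  ultimately show ?thesis
    using assms by (simp add: qpochs_def qpochhammer_eq_0_iff)
qed

definition summand :: "'a::field \<Rightarrow> 'a \<Rightarrow> 'a \<Rightarrow> 'a \<Rightarrow> nat \<Rightarrow> 'a" where
  "summand q a b c k = qint q (3 * k + 1)
       * (qpochs [a * q, q / a, q] (q ^ 2) k * qpochs [q / b, q / c, b * c] q k)
       / (qpochs [a * q, q / a, q] q k
          * qpochs [b * q ^ 2, c * q ^ 2, q ^ 3 / (b * c)] (q ^ 2) k)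
       * q ^ k"

lemma qint_field: "q \<noteq> 1 \<Longrightarrow> qint q m = (1 - q ^ m) / (1 - (q::'a::field))"
  using qint_mult [of q m] by (simp add: field_simps)

text \<open>The factor \<open>q ^ j\<close> is the quotient of the normalising powers
  \<open>q ^ (2 * j)\<close> in \<open>xnode_diff\<close> and \<open>q ^ j\<close> in
  \<open>cpole_diff\<close>.\<close>

lemma poch_shift_pair:
  fixes q A d :: "'a::field"
  assumes q: "q \<noteq> 0" "d \<noteq> 0"
  shows "(\<Prod>j<k. q ^ j) * (\<Prod>j<k. (xnode q A j - (d + A * q / d)) / (cpole q A j - (d + A * q / d))) =
    (qpochhammer d (q ^ 2) k * qpochhammer (A * q / d) (q ^ 2) k) / (qpochhammer d q k * qpochhammer (A * q / d) q k)"
proof -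
  have e: "q ^ j * (u / v) = (q ^ (2 * j) * u) / (q ^ j * v)" for u v j
    using q by (simp add: mult_2 power_add)
  have "(\<Prod>j<k. q ^ j) * (\<Prod>j<k. (xnode q A j - (d + A * q / d)) / (cpole q A j - (d + A * q / d)))
    = (\<Prod>j<k. ((1 - d * q ^ (2 * j)) * (1 - A * q / d * q ^ (2 * j))) / ((1 - d * q ^ j) * (1 - A * q / d * q ^ j)))"
    unfolding prod.distrib [symmetric] xnode_diff [OF q, symmetric] cpole_diff [OF q, symmetric]
    by (intro prod.cong refl) (unfold cpole_even, rule e)
  also have "\<dots> = (\<Prod>j<k. (1 - d * q ^ (2 * j)) * (1 - A * q / d * q ^ (2 * j))) / (\<Prod>j<k. (1 - d * q ^ j) * (1 - A * q / d * q ^ j))"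
    by (rule prod_dividef)
  also have "\<dots> = (qpochhammer d (q ^ 2) k * qpochhammer (A * q / d) (q ^ 2) k) / (qpochhammer d q k * qpochhammer (A * q / d) q k)"
    unfolding prod.distrib qpochhammer_def power_mult ..
  finally show ?thesis .
qed

lemma summand_alpha_gen:
  fixes q a b c :: "'a::field"
  assumes "q \<noteq> 0" "q \<noteq> 1" "a \<noteq> 0" "b \<noteq> 0" "c \<noteq> 0"
  defines "X \<equiv> a * q + q / a"
  shows "summand q a b c k = (\<Prod>j<k. (xnode q q j - X) / (cpole q q j - X)) * alpha_gen q q (q / b) (q / c) k"
proof -
  have X: "X = a * q + q * q / (a * q)" using assms by (simp add: X_def)
  have d: "a * q \<noteq> 0" using assms by simp
  have r: "q * q / (a * q) = q / a" "q * q / (q / b * (q / c)) = b * c" "q * q\<^sup>2 / (q / b) = b * q ^ 2"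
    "q * q\<^sup>2 / (q / c) = c * q ^ 2" "q / b * (q / c) * q = q ^ 3 / (b * c)" "q * q ^ (3 * k) = q ^ (3 * k + 1)"
    using assms(1-5) by (simp_all add: power2_eq_square power3_eq_cube)
  have ps: "(\<Prod>j<k. q ^ j) * (\<Prod>j<k. (xnode q q j - X) / (cpole q q j - X)) =
    (qpochhammer (a * q) (q ^ 2) k * qpochhammer (q / a) (q ^ 2) k) / (qpochhammer (a * q) q k * qpochhammer (q / a) q k)"
    using poch_shift_pair [OF assms(1) d, of k q] unfolding X_def r(1) .
  have "(\<Prod>j<k. (xnode q q j - X) / (cpole q q j - X)) * alpha_gen q q (q / b) (q / c) k
    = ((\<Prod>j<k. q ^ j) * (\<Prod>j<k. (xnode q q j - X) / (cpole q q j - X))) *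
      (qint q (3 * k + 1) * (qpochhammer q (q ^ 2) k * qpochs [q / b, q / c, b * c] q k) /
       (qpochhammer q q k * qpochs [b * q ^ 2, c * q ^ 2, q ^ 3 / (b * c)] (q ^ 2) k) * q ^ k)"
    unfolding alpha_gen_def r qint_field [OF assms(2)] by (simp add: mult_ac)
  also have "\<dots> = summand q a b c k"
    unfolding ps summand_def qpochs_def by (simp add: mult_ac)
  finally show ?thesis ..
qed

text \<open>The factor \<open>[2N + 1]\<close> is the quotient of the symbols with parameters
  \<open>q ^ 3\<close> and \<open>q\<close>, both of base \<open>q ^ 2\<close> and length
  \<open>N\<close>.\<close>

lemma beta_gen_rhs:
  fixes q b c :: "'a::field"
  assumes "q \<noteq> 0" "q \<noteq> 1" "b \<noteq> 0" "c \<noteq> 0" "qpochhammer q (q ^ 2) N \<noteq> 0"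
  shows "beta_gen q q (q / b) (q / c) N =
    qpochs [b * c * q, q ^ 2 / b, q ^ 2 / c] (q ^ 2) N
       / qpochs [q ^ 3 / (b * c), b * q ^ 2, c * q ^ 2] (q ^ 2) N * qint q (2 * N + 1)"
proof -
  have r: "q / b * q = q ^ 2 / b" "q / c * q = q ^ 2 / c" "q * q\<^sup>2 / (q / b * (q / c)) = b * c * q" "q * q\<^sup>2 / (q / b) = b * q ^ 2"
    "q * q\<^sup>2 / (q / c) = c * q ^ 2" "q / b * (q / c) * q = q ^ 3 / (b * c)"
    using assms(1-4) by (simp_all add: power2_eq_square power3_eq_cube)
  have "(1 - q) * qpochhammer (q * q ^ 2) (q ^ 2) N = qpochhammer q (q ^ 2) N * (1 - q ^ (2 * N + 1))"
    using qpochhammer_add [of q "q ^ 2" 1 N] qpochhammer_add [of q "q ^ 2" N 1]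
    by (simp add: power_mult add.commute)
  then have "qpochhammer (q * q ^ 2) (q ^ 2) N = qpochhammer q (q ^ 2) N * qint q (2 * N + 1)"
    unfolding qint_field [OF assms(2)] using assms(2) by (simp add: field_simps)
  then show ?thesis unfolding beta_gen_def r qpochs_def using assms(5) by (simp add: mult_ac)
qed

text \<open>Inserting the expansion of \<open>alpha_gen\<close> and exchanging the sums leaves the
  inner sum of \<open>rational_lagrange\<close>. Only even powers of \<open>q\<close> up to
  \<open>4 * n\<close> must differ from 1, so \<open>q\<close> may also be a root of unity of order
  \<open>2 * n + 1\<close>.\<close>

lemma sum_summand:
  fixes q a b c :: "'a::field"
  assumes q: "q \<noteq> 0" "q \<noteq> 1" and a: "a \<noteq> 0" "\<And>j. j < n \<Longrightarrow> a * q ^ (j + 1) \<noteq> 1" "\<And>j. j < n \<Longrightarrow> q ^ (j + 1) \<noteq> a"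
    and b: "generic_wrt q b" and c: "generic_wrt q c" and bc: "generic_wrt q (b * c)"
    and qi: "\<And>i. 0 < i \<Longrightarrow> i \<le> 2 * n \<Longrightarrow> q ^ (2 * i) \<noteq> 1"
  defines "X \<equiv> a * q + q / a" and "x \<equiv> xnode q q"
  shows "(\<Sum>k\<le>n. summand q a b c k) = (\<Sum>m\<le>n. beta_gen q q (q / b) (q / c) m *
    ((\<Prod>j\<in>{..n} - {m}. (x j - X) / (x j - x m)) * (\<Prod>j<n. (cpole q q j - x m) / (cpole q q j - X))))"
    and "inj_on x {..n}" and "\<And>j. j < n \<Longrightarrow> cpole q q j \<noteq> X"
proof -
  have b0: "b \<noteq> 0" "q / b \<noteq> 0" and c0: "c \<noteq> 0" "q / c \<noteq> 0"
    using b c q by (auto simp: generic_wrt_def)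
  have X: "X = a * q + q * q / (a * q)" using q a by (simp add: X_def)
  have qi': "q ^ i \<noteq> 1" if "0 < i" "i \<le> 2 * n" for i
    using qi [OF that] by (auto simp: mult_2 power_add)
  \<comment> \<open>Two nodes coincide only if \<open>q ^ (2 * (j - i)) = 1\<close> or
    \<open>q ^ (2 * (i + j + 1)) = 1\<close>; both exponents lie in the range of
    \<open>qi\<close>.\<close>
  have ne: "x i \<noteq> x j" if "i < j" "j \<le> n" for i j
  proof
    assume e: "x i = x j"
    let ?d = "1 / q ^ (2 * j)"
    have d: "?d \<noteq> 0" using q by simp
    have "(1 - ?d * q ^ (2 * i)) * (1 - q * q / ?d * q ^ (2 * i)) = q ^ (2 * i) * (x i - x j)"
      unfolding x_def xnode_alt [OF q(1), of q j] by (rule xnode_diff [OF q(1) d, symmetric])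
    then have "q ^ (2 * i) = q ^ (2 * j) \<or> q * q * q ^ (2 * j) * q ^ (2 * i) = 1"
      using e q by auto
    moreover have "q ^ (2 * j) = q ^ (2 * i) * q ^ (2 * (j - i))"
    proof -
      have "2 * j = 2 * i + 2 * (j - i)" using that by simp
      then show ?thesis by (metis power_add)
    qed
    moreover have "q * q * q ^ (2 * j) * q ^ (2 * i) = q ^ (2 * (i + j + 1))"
      by (simp add: power_add mult_2 mult_ac)
    ultimately show False using qi [of "j - i"] qi [of "i + j + 1"] that q by auto
  qed
  then show inj: "inj_on x {..n}"
    by (intro inj_onI) (metis atMost_iff linorder_neqE_nat)
  show cX: "cpole q q j \<noteq> X" if "j < n" for j
  proof
    assume "cpole q q j = X"
    then have "(1 - a * q * q ^ j) * (1 - q * q / (a * q) * q ^ j) = 0"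
      using cpole_diff [of q "a * q" j q] q a(1) unfolding X by simp
    then show False using a(1) a(2,3) [OF that] q by (auto simp: mult_ac)
  qed
  have al: "alpha_gen q q (q / b) (q / c) k = (\<Sum>m\<le>k. lagr_inv x (cpole q q) k m * beta_gen q q (q / b) (q / c) m)"
    if k: "k \<le> n" for k
    unfolding x_def
  proof (rule alpha_gen_eq_sum [OF q(1) c0(2) b0(2) q(2)])
    show "q / c * q ^ i \<noteq> 1" for i
      using c c0 by (auto simp: generic_wrt_def simp flip: power_Suc)
    show "q ^ i \<noteq> q / c" for i
    proof (cases i)
      case 0
      then show ?thesis using c c0 by (auto simp: generic_wrt_def field_simps dest: spec [of _ 1])
    next
      case (Suc j)
      then show ?thesis using c c0 q by (auto simp: generic_wrt_def field_simps)
    qed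
    show "q ^ i \<noteq> 1" if "0 < i" "i \<le> 2 * k" for i using qi' [of i] that k by simp
    show "inj_on (xnode q q) {..k}" using inj k unfolding x_def by (auto intro: inj_on_subset)
    have r: "q * q\<^sup>2 / (q / b) = b * q ^ 2" "q * q\<^sup>2 / (q / c) = c * q ^ 2" "q / b * (q / c) * q = q ^ 3 / (b * c)"
      using q b0 c0 by (simp_all add: power2_eq_square power3_eq_cube)
    show "qpochs [q * q\<^sup>2 / (q / b), q * q\<^sup>2 / (q / c), q / b * (q / c) * q] (q\<^sup>2) k \<noteq> 0"
      unfolding r using generic_denominators [OF b c bc] .
  qed
  have "(\<Sum>k\<le>n. summand q a b c k) =
    (\<Sum>k\<le>n. \<Sum>m\<le>k. beta_gen q q (q / b) (q / c) m * ((\<Prod>j<k. (x j - X) / (cpole q q j - X)) * lagr_inv x (cpole q q) k m))"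
    unfolding summand_alpha_gen [OF q a(1) b0(1) c0(1)] X_def [symmetric] x_def [symmetric]
    by (intro sum.cong) (simp_all add: al sum_distrib_left mult_ac)
  also have "\<dots> = (\<Sum>m\<le>n. \<Sum>k=m..n. beta_gen q q (q / b) (q / c) m * ((\<Prod>j<k. (x j - X) / (cpole q q j - X)) * lagr_inv x (cpole q q) k m))"
    unfolding sum.Sigma [OF finite_atMost ballI [OF finite_atMost]]
      sum.Sigma [OF finite_atMost ballI [OF finite_atLeastAtMost]]
    by (rule sum.reindex_bij_witness [of _ "\<lambda>(m, k). (k, m)" "\<lambda>(k, m). (m, k)"]) auto
  also have "\<dots> = (\<Sum>m\<le>n. beta_gen q q (q / b) (q / c) m *
    ((\<Prod>j\<in>{..n} - {m}. (x j - X) / (x j - x m)) * (\<Prod>j<n. (cpole q q j - x m) / (cpole q q j - X))))"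
    unfolding sum_distrib_left [symmetric]
    by (intro sum.cong refl arg_cong2 [where f = "(*)"] rational_lagrange inj cX) auto
  finally show "(\<Sum>k\<le>n. summand q a b c k) = \<dots>" .
qed

definition qrhs :: "'a::field \<Rightarrow> 'a \<Rightarrow> 'a \<Rightarrow> nat \<Rightarrow> 'a" where
  "qrhs q b c N = qpochs [b * c * q, q ^ 2 / b, q ^ 2 / c] (q ^ 2) N
       / qpochs [q ^ 3 / (b * c), b * q ^ 2, c * q ^ 2] (q ^ 2) N * qint q (2 * N + 1)"

text \<open>Here \<open>X\<close> is the node of index \<open>N\<close>, so every Lagrange weight is
  zero except the one for \<open>m = N\<close>, which is 1.\<close>

lemma sum_summand_terminating:
  fixes q a b c :: "'a::field"
  assumes q: "q \<noteq> 0" "\<And>i. 0 < i \<Longrightarrow> q ^ i \<noteq> 1"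
    and a: "a = q ^ (2 * N + 1) \<or> a = 1 / q ^ (2 * N + 1)"
    and gen: "generic_wrt q b" "generic_wrt q c" "generic_wrt q (b * c)"
    and M: "M = 2 * N \<or> M = N"
  shows "(\<Sum>k=0..M. summand q a b c k) = qrhs q b c N"
proof -
  have q1: "q \<noteq> 1" using q(2) [of 1] by simp
  have a0: "a \<noteq> 0" using a q by auto
  have pw: "q ^ i \<noteq> q ^ j" if "i < j" for i j
  proof
    assume "q ^ i = q ^ j"
    then have "q ^ (j - i) = 1" using q(1) that by (intro power_diff_eq_1) auto
    then show False using q(2) that by auto
  qed
  have a1: "a * q ^ (j + 1) \<noteq> 1" "q ^ (j + 1) \<noteq> a" if "j < N" for j
  proof -
    define Q R where "Q = q ^ (2 * N + 1)" and "R = q ^ (j + 1)"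
    have "Q * R \<noteq> 1"
      unfolding Q_def R_def power_add [symmetric] by (rule q(2)) simp
    moreover have "R \<noteq> Q" unfolding Q_def R_def by (rule pw) (use that in simp)
    moreover have "a = Q \<or> a = 1 / Q" "Q \<noteq> 0" using a q by (simp_all add: Q_def)
    moreover have "1 / Q * R \<noteq> 1" "R \<noteq> 1 / Q" using calculation by auto
    ultimately have "a * R \<noteq> 1 \<and> R \<noteq> a" by (elim disjE) simp_all
    then show "a * q ^ (j + 1) \<noteq> 1" "q ^ (j + 1) \<noteq> a" by (simp_all add: R_def)
  qed
  have qi: "q ^ (2 * i) \<noteq> 1" if "0 < i" for i using q(2) [of "2 * i"] that by simp
  have X: "a * q + q / a = xnode q q N"
    using a q by (auto simp: xnode_def)
  have ss: "(\<Sum>k\<le>N. summand q a b c k) = (\<Sum>m\<le>N. beta_gen q q (q / b) (q / c) m *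
      ((\<Prod>j\<in>{..N} - {m}. (xnode q q j - xnode q q N) / (xnode q q j - xnode q q m)) *
       (\<Prod>j<N. (cpole q q j - xnode q q m) / (cpole q q j - xnode q q N))))"
    "inj_on (xnode q q) {..N}" "\<And>j. j < N \<Longrightarrow> cpole q q j \<noteq> xnode q q N"
    using sum_summand [where n = N and a = a, OF q(1) q1 a0 a1 gen qi] unfolding X by blast+
  have "(\<Sum>k\<le>N. summand q a b c k) = (\<Sum>m\<in>{N}. beta_gen q q (q / b) (q / c) m)"
  proof -
    have z: "(\<Prod>j\<in>{..N} - {m}. (xnode q q j - xnode q q N) / (xnode q q j - xnode q q m)) = 0" if "m < N" for m
      using that by (intro prod_zero) auto
    have o: "(\<Prod>j\<in>{..N} - {N}. (xnode q q j - xnode q q N) / (xnode q q j - xnode q q N)) = 1"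
      using ss(2) by (intro prod.neutral) (auto simp: inj_on_def)
    have o2: "(\<Prod>j<N. (cpole q q j - xnode q q N) / (cpole q q j - xnode q q N)) = 1"
      using ss(3) by (intro prod.neutral) auto
    show ?thesis
      unfolding ss(1)
    proof (rule sum.mono_neutral_cong_right)
      show "\<forall>m\<in>{..N} - {N}. beta_gen q q (q / b) (q / c) m *
        ((\<Prod>j\<in>{..N} - {m}. (xnode q q j - xnode q q N) / (xnode q q j - xnode q q m)) *
         (\<Prod>j<N. (cpole q q j - xnode q q m) / (cpole q q j - xnode q q N))) = 0"
        (is "\<forall>m\<in>_. ?P m")
      proof
        fix m assume "m \<in> {..N} - {N}"
        then have "m < N" by auto
        then show "?P m" by (simp only: z mult_zero_left mult_zero_right)
      qed
    qed (simp_all only: o o2 singleton_iff mult_1_right finite_atMost, simp_all)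
  qed
  also have "\<dots> = qrhs q b c N"
  proof -
    have "qpochhammer q (q ^ 2) N \<noteq> 0"
      using q(2) by (auto simp: qpochhammer_eq_0_iff simp flip: power_mult power_Suc)
    moreover have "b \<noteq> 0" "c \<noteq> 0" using gen by (auto simp: generic_wrt_def)
    ultimately show ?thesis using beta_gen_rhs [OF q(1) q1, of b c N] by (simp add: qrhs_def)
  qed
  \<comment> \<open>For \<open>k > N\<close> one of the numerator factors
    \<open>1 - a * q * (q ^ 2) ^ N\<close> and \<open>1 - q / a * (q ^ 2) ^ N\<close> is zero, so
    both choices of \<open>M\<close> give the same sum.\<close>
  also have "(\<Sum>k\<le>N. summand q a b c k) = (\<Sum>k=0..M. summand q a b c k)"
  proof (rule sum.mono_neutral_left)
    show "{..N} \<subseteq> {0..M}" using M by auto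
    show "\<forall>k\<in>{0..M} - {..N}. summand q a b c k = 0"
    proof
      fix k assume "k \<in> {0..M} - {..N}"
      then have k: "N < k" by auto
      have "(q ^ 2) ^ N * q = q ^ (2 * N + 1)" by (simp add: power_mult)
      then have "a * q * (q ^ 2) ^ N = 1 \<or> q / a * (q ^ 2) ^ N = 1"
        using a q by (auto simp: mult_ac)
      then have "qpochhammer (a * q) (q ^ 2) k * qpochhammer (q / a) (q ^ 2) k = 0"
        using k by (auto simp: qpochhammer_eq_0_iff)
      then show "summand q a b c k = 0" by (auto simp: summand_def qpochs_def)
    qed
  qed simp
  finally show ?thesis .
qed

text \<open>For \<open>m = N\<close> the numerator of \<open>beta_gen\<close> contains
  \<open>1 - q ^ (2 * N + 1)\<close>. For \<open>m < N\<close> the node of index \<open>m\<close> is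
  also one of the poles of index below \<open>N\<close>, so its Lagrange weight vanishes.\<close>

lemma sum_summand_root_of_unity:
  fixes q a b c :: "'a::field"
  assumes ord: "\<And>i. q ^ i = 1 \<longleftrightarrow> (2 * N + 1) dvd i" and N: "N > 0"
    and gen: "generic_wrt q a" "generic_wrt q b" "generic_wrt q c" "generic_wrt q (b * c)"
  shows "(\<Sum>k\<le>N. summand q a b c k) = 0"
proof -
  have q0: "q \<noteq> 0" using ord [of "2 * N + 1"] by auto
  have q1: "q \<noteq> 1" using ord [of 1] N by simp
  have qi: "q ^ (2 * i) \<noteq> 1" if "0 < i" "i \<le> 2 * N" for i
  proof -
    have "coprime (2 * N + 1) 2" by simp
    then show ?thesis using ord [of "2 * i"] that coprime_dvd_mult_right_iff [of "2 * N + 1" 2 i]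
      by (auto dest: dvd_imp_le)
  qed
  have a: "a \<noteq> 0" "\<And>j. a * q ^ (j + 1) \<noteq> 1" "\<And>j. q ^ (j + 1) \<noteq> a"
    using gen(1) unfolding generic_wrt_def by blast+
  have ss: "(\<Sum>k\<le>N. summand q a b c k) = (\<Sum>m\<le>N. beta_gen q q (q / b) (q / c) m *
      ((\<Prod>j\<in>{..N} - {m}. (xnode q q j - (a * q + q / a)) / (xnode q q j - xnode q q m)) *
       (\<Prod>j<N. (cpole q q j - xnode q q m) / (cpole q q j - (a * q + q / a)))))"
    "inj_on (xnode q q) {..N}" "\<And>j. j < N \<Longrightarrow> cpole q q j \<noteq> (a * q + q / a)"
    using sum_summand [where n = N and a = a, OF q0 q1 a gen(2-4) qi] by blast+
  have "beta_gen q q (q / b) (q / c) N = 0"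
  proof -
    have "q * q ^ 2 * (q ^ 2) ^ (N - 1) = q ^ (2 * N + 1)"
    proof -
      have "q * q ^ 2 * (q ^ 2) ^ (N - 1) = q ^ (1 + 2 + 2 * (N - 1))"
        unfolding power_add power_mult by simp
      moreover have "1 + 2 + 2 * (N - 1) = 2 * N + 1" using N by simp
      ultimately show ?thesis by metis
    qed
    also have "\<dots> = 1" by (rule ord [THEN iffD2]) simp
    finally have "qpochhammer (q * q ^ 2) (q ^ 2) N = 0"
      unfolding qpochhammer_eq_0_iff using N by (intro exI [of _ "N - 1"]) simp
    then show ?thesis by (simp add: beta_gen_def qpochs_def)
  qed
  moreover have "(\<Prod>j<N. (cpole q q j - xnode q q m) / (cpole q q j - (a * q + q / a))) = 0" if m: "m < N" for m
  proof (cases "2 * m < N")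
    case True
    then show ?thesis using cpole_even [of q q m] by (intro prod_zero) (auto intro!: bexI [of _ "2 * m"])
  next
    case False
    \<comment> \<open>With \<open>j + (2 * m + 2) = 2 * N + 1\<close> the two terms of the pole of
      index \<open>j\<close> are those of the node of index \<open>m\<close> in the opposite order.
      The case \<open>2 * m \<ge> N\<close> makes \<open>j < N\<close>.\<close>
    define j where "j = 2 * N - 1 - 2 * m"
    have j: "j < N" "j + (2 * m + 2) = 2 * N + 1" using False m by (auto simp: j_def)
    have e: "q ^ j * q ^ (2 * m + 2) = 1"
      using ord [of "2 * N + 1"] unfolding power_add [symmetric] j by simp
    have "cpole q q j = xnode q q m"
    proof -
      have "1 / q ^ j = q ^ (2 * m + 2)" using e q0 by (simp add: divide_eq_eq mult.commute)
      moreover have "q ^ (2 * m + 2) = q * q ^ (2 * m + 1)" by simp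
      moreover have "1 / q ^ (2 * m) = q * q ^ (j + 1)"
        using e q0 by (simp add: divide_eq_eq mult_ac)
      ultimately show ?thesis unfolding cpole_def xnode_def by simp
    qed
    then show ?thesis using j by (intro prod_zero) (auto intro!: bexI [of _ j])
  qed
  ultimately have "beta_gen q q (q / b) (q / c) m *
      ((\<Prod>j\<in>{..N} - {m}. (xnode q q j - (a * q + q / a)) / (xnode q q j - xnode q q m)) *
       (\<Prod>j<N. (cpole q q j - xnode q q m) / (cpole q q j - (a * q + q / a)))) = 0" if "m \<le> N" for m
    using that by (cases "m = N") (simp_all only: mult_zero_left mult_zero_right le_neq_implies_less)
  then show ?thesis unfolding ss(1) by (intro sum.neutral) blast
qed

section \<open>Block sums at a root of unity\<close>

definition wfac :: "'a::field \<Rightarrow> 'a \<Rightarrow> 'a \<Rightarrow> 'a \<Rightarrow> nat \<Rightarrow> 'a" where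
  "wfac q a b c k = (qpochs [a * q, q / a] (q ^ 2) k * qpochs [q / b, q / c, b * c] q k) /
    (qpochs [a * q, q / a] q k * qpochs [b * q ^ 2, c * q ^ 2, q ^ 3 / (b * c)] (q ^ 2) k)"

text \<open>Separates the quotient of \<open>(q; q^2)_k\<close> and \<open>(q; q)_k\<close>, which
  can take the form 0/0 at a root of unity, from the factors that stay regular there.\<close>

lemma summand_wfac:
  "summand q a b c k = qint q (3 * k + 1) * (qpochhammer q (q ^ 2) k / qpochhammer q q k * wfac q a b c k) * q ^ k"
  by (simp add: summand_def wfac_def qpochs_def mult_ac)

lemma qpochhammer_periodic:
  assumes "p ^ l = 1"
  shows "qpochhammer x p (l + r) = qpochhammer x p l * qpochhammer x p r"
  by (simp add: qpochhammer_add assms)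

lemma wfac_periodic:
  assumes "q ^ l = 1"
  shows "wfac q a b c (l + r) = wfac q a b c l * wfac q a b c r"
proof -
  have "(q ^ 2) ^ l = 1" using assms by (simp flip: power_mult add: mult.commute [of 2] power_mult)
  then show ?thesis using assms
    by (simp add: wfac_def qpochs_def qpochhammer_periodic mult_ac)
qed

text \<open>\<open>y\<close> stands for the values of the quotient of \<open>(q; q^2)_k\<close> and
  \<open>(q; q)_k\<close> at the root of unity. The recurrence leaves \<open>y l\<close>
  undetermined at positive multiples \<open>l\<close> of the order, but whatever these values are,
  each block is a multiple of the first.\<close>

lemma block_sum_root_of_unity:
  fixes q a b c :: "'a::field" and y :: "nat \<Rightarrow> 'a"
  assumes ord: "\<And>i. q ^ i = 1 \<longleftrightarrow> (2 * N + 1) dvd i" and N: "N > 0"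
    and gen: "generic_wrt q a" "generic_wrt q b" "generic_wrt q c" "generic_wrt q (b * c)"
    and y: "y 0 = 1" "\<And>k. y (Suc k) * (1 - q ^ (k + 1)) = y k * (1 - q ^ (2 * k + 1))"
    and n: "odd n" "(2 * N + 1) dvd n" and M: "M = n - 1 \<or> M = (n - 1) div 2"
  shows "(\<Sum>k=0..M. qint q (3 * k + 1) * (y k * wfac q a b c k) * q ^ k) = 0"
proof -
  define d where "d = 2 * N + 1"
  define T where "T k = qint q (3 * k + 1) * (y k * wfac q a b c k) * q ^ k" for k
  have q1: "q \<noteq> 1" using ord [of 1] N by simp
  have qne: "1 - q ^ (r + 1) \<noteq> 0" if "r + 1 < d" for r
    using ord [of "r + 1"] that by (auto simp: d_def dest: dvd_imp_le)
  \<comment> \<open>Below the order the factor \<open>1 - q ^ (r + 1)\<close> can be cancelled, so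
    the recurrence restarts at \<open>l\<close> with initial value \<open>y l\<close>.\<close>
  have per: "y (l + r) = y l * y r" if "d dvd l" "r < d" for l r
    using that(2)
  proof (induction r)
    case (Suc r)
    have "y (l + Suc r) * (1 - q ^ (l + r + 1)) = y (l + r) * (1 - q ^ (2 * (l + r) + 1))"
      using y(2) [of "l + r"] by simp
    moreover have l: "q ^ l = 1" using ord that(1) by (simp add: d_def)
    moreover have "q ^ (2 * (l + r) + 1) = q ^ l * q ^ l * q ^ (2 * r + 1)"
    proof -
      have "2 * (l + r) + 1 = l + l + (2 * r + 1)" by simp
      then show ?thesis by (metis power_add)
    qed
    ultimately have "y (l + Suc r) * (1 - q ^ (r + 1)) = y l * (y r * (1 - q ^ (2 * r + 1)))"
      using Suc by (simp add: power_add)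
    also have "\<dots> = y l * y (Suc r) * (1 - q ^ (r + 1))" using y(2) [of r] by simp
    finally show ?case using qne [of r] Suc.prems by simp
  qed (simp add: y)
  have Tper: "T (l + r) = (y l * wfac q a b c l) * T r" if "d dvd l" "r < d" for l r
  proof -
    have l: "q ^ l = 1" using ord that(1) by (simp add: d_def)
    have "q ^ (3 * (l + r) + 1) = (q ^ l) ^ 3 * q ^ (3 * r + 1)"
      by (simp add: power_add algebra_simps flip: power_mult)
    then have "qint q (3 * (l + r) + 1) = qint q (3 * r + 1)"
      using l by (simp add: qint_field [OF q1])
    then show ?thesis unfolding T_def per [OF that] wfac_periodic [OF l] using l
      by (simp add: power_add mult_ac)
  qed
  have yr: "y r = qpochhammer q (q ^ 2) r / qpochhammer q q r \<and> qpochhammer q q r \<noteq> 0" if "r < d" for r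
    using that
  proof (induction r)
    case (Suc r)
    have "q * q ^ r \<noteq> 1" using qne [of r] Suc.prems by simp
    then have "y (Suc r) = y r * (1 - q ^ (2 * r + 1)) / (1 - q * q ^ r)"
      using y(2) [of r] by (simp add: field_simps)
    then show ?case using Suc \<open>q * q ^ r \<noteq> 1\<close> by (simp add: power_mult)
  qed (simp add: y)
  have Tsum: "(\<Sum>r\<le>N. T r) = 0"
  proof -
    have "T r = summand q a b c r" if "r \<le> N" for r
      using yr [of r] that by (simp add: T_def summand_wfac d_def)
    then have "(\<Sum>r\<le>N. T r) = (\<Sum>r\<le>N. summand q a b c r)" by (intro sum.cong) auto
    then show ?thesis using sum_summand_root_of_unity [OF ord N gen] by simp
  qed
  \<comment> \<open>The second half of a block is zero termwise, so the first \<open>N + 1\<close>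
    terms already sum to the whole block.\<close>
  have T0: "T r = 0" if "N < r" "r < d" for r
  proof -
    have "q * (q ^ 2) ^ N = 1" using ord [of "2 * N + 1"] by (simp add: power_mult)
    then have "qpochhammer q (q ^ 2) r = 0" using that by (auto simp: qpochhammer_eq_0_iff)
    then show ?thesis using yr [of r] that by (simp add: T_def)
  qed
  have blk: "(\<Sum>r\<le>K. T (l + r)) = 0" if "d dvd l" "N \<le> K" "K < d" for l K
  proof -
    have "(\<Sum>r\<le>K. T (l + r)) = (y l * wfac q a b c l) * (\<Sum>r\<le>K. T r)"
      unfolding sum_distrib_left using that by (intro sum.cong) (auto simp: Tper)
    also have "(\<Sum>r\<le>K. T r) = (\<Sum>r\<le>N. T r)"
      using that by (intro sum.mono_neutral_right) (auto simp: T0)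
    finally show ?thesis by (simp add: Tsum)
  qed
  have full: "(\<Sum>k<s * d. T k) = 0" for s
  proof (induction s)
    case (Suc s)
    have "(\<Sum>k<Suc s * d. T k) = (\<Sum>k<s * d. T k) + (\<Sum>k=s * d..<s * d + d. T k)"
      using sum.atLeastLessThan_concat [of 0 "s * d" "s * d + d" T] by (simp add: atLeast0LessThan add.commute)
    also have "(\<Sum>k=s * d..<s * d + d. T k) = (\<Sum>r<d. T (s * d + r))"
      using sum.shift_bounds_nat_ivl [of T 0 "s * d" d] by (simp add: add.commute atLeast0LessThan)
    also have "\<dots> = (\<Sum>r\<le>2 * N. T (s * d + r))"
      by (intro sum.cong) (auto simp: d_def)
    also have "\<dots> = 0" by (rule blk [OF dvd_triv_right]) (auto simp: d_def)
    finally show ?case using Suc by simp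
  qed simp
  obtain m where m: "n = d * m" using n(2) by (auto simp: d_def)
  then have "odd m" using n(1) by simp
  then obtain s where s: "m = 2 * s + 1" by (auto elim: oddE)
  have "(\<Sum>k=0..M. T k) = 0"
    using M
  proof
    assume "M = n - 1"
    then have "{0..M} = {..<m * d}" using m s by (auto simp: d_def mult.commute)
    then show ?thesis by (simp add: full)
  next
    assume "M = (n - 1) div 2"
    \<comment> \<open>Since \<open>m = 2 * s + 1\<close>, the shorter range consists of
      \<open>s\<close> full blocks and the first \<open>N + 1\<close> terms of the next one.\<close>
    then have Ms: "M = s * d + N" using m s by (simp add: d_def algebra_simps)
    have "(\<Sum>k=0..M. T k) = (\<Sum>k<s * d. T k) + (\<Sum>k=s * d..<s * d + Suc N. T k)"
      using sum.atLeastLessThan_concat [of 0 "s * d" "s * d + Suc N" T]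
      by (simp add: Ms atLeast0LessThan atLeast0AtMost lessThan_Suc_atMost)
    also have "(\<Sum>k=s * d..<s * d + Suc N. T k) = (\<Sum>r\<le>N. T (s * d + r))"
      using sum.shift_bounds_nat_ivl [of T 0 "s * d" "Suc N"] by (simp add: add.commute atLeast0LessThan lessThan_Suc_atMost)
    also have "\<dots> = 0" by (rule blk [OF dvd_triv_right]) (auto simp: d_def)
    finally show ?thesis by (simp add: full)
  qed
  then show ?thesis by (simp add: T_def)
qed

section \<open>Specialisation at roots of unity\<close>

text \<open>The Gaussian binomial coefficient by the \<open>q\<close>-Pascal rule. Being free of
  division, it can be specialised at every place.\<close>

fun gauss_binomial :: "'a::comm_ring_1 \<Rightarrow> nat \<Rightarrow> nat \<Rightarrow> 'a" where
  "gauss_binomial q n 0 = 1"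
| "gauss_binomial q 0 (Suc k) = 0"
| "gauss_binomial q (Suc n) (Suc k) = gauss_binomial q n k + q ^ Suc k * gauss_binomial q n (Suc k)"

lemma gauss_binomial_eq_0: "n < k \<Longrightarrow> gauss_binomial q n k = 0"
  by (induction q n k rule: gauss_binomial.induct) auto

text \<open>The two terms of the \<open>q\<close>-Pascal rule contribute the factors
  \<open>1 - q ^ k\<close> and \<open>q ^ k * (1 - q ^ m)\<close>, whose sum is
  \<open>1 - q ^ (m + k)\<close>.\<close>

lemma gauss_binomial_qpochhammer:
  "gauss_binomial q (m + k) k * (qpochhammer q q k * qpochhammer q q m) = qpochhammer q q (m + k)"
proof (induction "m + k" arbitrary: m k)
  case (Suc n)
  show ?case
  proof (cases k)
    case k: (Suc k')
    have n: "n = m + k'" using Suc(2) k by simp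
    have 1: "gauss_binomial q n k' * (qpochhammer q q k' * qpochhammer q q m) = qpochhammer q q n"
      using Suc(1) [OF n] n by simp
    have 2: "gauss_binomial q n (Suc k') * (qpochhammer q q (Suc k') * qpochhammer q q m) = (1 - q ^ m) * qpochhammer q q n"
    proof (cases m)
      case 0
      then show ?thesis using n by (simp add: gauss_binomial_eq_0)
    next
      case (Suc m')
      then have "gauss_binomial q n (Suc k') * (qpochhammer q q (Suc k') * qpochhammer q q m') = qpochhammer q q n"
        using Suc.hyps(1) [of m' "Suc k'"] n by simp
      moreover have "gauss_binomial q n (Suc k') * (qpochhammer q q (Suc k') * qpochhammer q q m) =
        (1 - q ^ m) * (gauss_binomial q n (Suc k') * (qpochhammer q q (Suc k') * qpochhammer q q m'))"
        using Suc by (simp add: mult_ac)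
      ultimately show ?thesis by simp
    qed
    have "gauss_binomial q (m + k) k * (qpochhammer q q k * qpochhammer q q m) =
      (1 - q ^ Suc k') * (gauss_binomial q n k' * (qpochhammer q q k' * qpochhammer q q m)) +
      q ^ Suc k' * (gauss_binomial q n (Suc k') * (qpochhammer q q (Suc k') * qpochhammer q q m))"
      using n k by (simp add: algebra_simps)
    also have "\<dots> = (1 - q ^ (m + k)) * qpochhammer q q n"
      unfolding 1 2 k by (simp add: algebra_simps power_add)
    also have "\<dots> = qpochhammer q q (m + k)" using n k by (simp add: mult.commute)
    finally show ?thesis .
  qed simp
qed simp

lemma qpochhammer_minus: "qpochhammer (x ^ 2) (p ^ 2) k = qpochhammer x p k * qpochhammer (- x) p k"
  by (induction k) (simp_all add: algebra_simps power2_eq_square power_mult_distrib)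

text \<open>Cancels the factors of \<open>(q; q)\<^sub>k\<close> that vanish at roots of unity of odd order.\<close>

lemma qpochhammer_ratio_gauss:
  fixes q :: "'a::field"
  assumes "qpochhammer q q k \<noteq> 0" "qpochhammer (- q) q k \<noteq> 0"
  shows "qpochhammer q (q ^ 2) k / qpochhammer q q k = gauss_binomial q (2 * k) k / qpochhammer (- q) q k"
proof -
  \<comment> \<open>Both sides are equal to \<open>qpochhammer q q (2 * k)\<close>.\<close>
  have "gauss_binomial q (2 * k) k * (qpochhammer q q k * qpochhammer q q k) =
    qpochhammer q (q ^ 2) k * (qpochhammer q q k * qpochhammer (- q) q k)"
    using gauss_binomial_qpochhammer [of q k k] qpochhammer_double [of q q k] qpochhammer_minus [of q q k]
    by (simp add: mult_2 power2_eq_square)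
  then show ?thesis using assms by (simp add: frac_eq_eq mult_ac)
qed

context fract_place
begin

lemma spec_gauss_binomial: "spec q q' \<Longrightarrow> spec (gauss_binomial q n k) (gauss_binomial q' n k)"
  by (induction q n k rule: gauss_binomial.induct) (auto intro!: spec_arith simp del: power_Suc)

lemma spec_wfac:
  assumes "spec q q'" "spec a a'" "spec b b'" "spec c c'" "a' \<noteq> 0" "b' \<noteq> 0" "c' \<noteq> 0"
    "qpochs [a' * q', q' / a'] q' k \<noteq> 0"
    "qpochs [b' * q' ^ 2, c' * q' ^ 2, q' ^ 3 / (b' * c')] (q' ^ 2) k \<noteq> 0"
  shows "spec (wfac q a b c k) (wfac q' a' b' c' k)"
  unfolding wfac_def using assms
  by (intro spec_divide spec_mult spec_qpochs) (auto intro!: spec_arith spec_divide)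

lemma spec_summand:
  assumes "spec q q'" "spec a a'" "spec b b'" "spec c c'" "a' \<noteq> 0" "b' \<noteq> 0" "c' \<noteq> 0"
    "qpochs [a' * q', q' / a'] q' k \<noteq> 0" "qpochhammer q' q' k \<noteq> 0"
    "qpochs [b' * q' ^ 2, c' * q' ^ 2, q' ^ 3 / (b' * c')] (q' ^ 2) k \<noteq> 0"
  shows "spec (summand q a b c k) (summand q' a' b' c' k)"
  unfolding summand_wfac using assms
  by (intro spec_arith spec_divide spec_wfac spec_qint spec_qpochhammer)

lemma spec_qrhs:
  assumes "spec q q'" "spec b b'" "spec c c'" "b' \<noteq> 0" "c' \<noteq> 0"
    "qpochs [b' * q' ^ 2, c' * q' ^ 2, q' ^ 3 / (b' * c')] (q' ^ 2) N \<noteq> 0"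
  shows "spec (qrhs q b c N) (qrhs q' b' c' N)"
  unfolding qrhs_def using assms
  by (intro spec_mult spec_divide spec_qpochs spec_qint) (auto intro!: spec_arith spec_divide simp: qpochs_def)

text \<open>Where \<open>q'\<close> is not a root of unity and \<open>a'\<close> is one of the two
  special powers, every summand is regular, and the difference of the values is zero by
  \<open>sum_summand_terminating\<close>.\<close>

lemma spec_identity:
  assumes sp: "spec q q'" "spec a a'" "spec b b'" "spec c c'"
    and q: "q' \<noteq> 0" "\<And>i. 0 < i \<Longrightarrow> q' ^ i \<noteq> 1"
    and a: "a' = q' ^ (2 * N + 1) \<or> a' = 1 / q' ^ (2 * N + 1)"
    and gen: "generic_wrt q' b'" "generic_wrt q' c'" "generic_wrt q' (b' * c')"
    and M: "M = 2 * N \<or> M = N"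
  shows "spec ((\<Sum>k=0..M. summand q a b c k) - qrhs q b c N) 0"
proof -
  have nz: "a' \<noteq> 0" "b' \<noteq> 0" "c' \<noteq> 0" using a q gen by (auto simp: generic_wrt_def)
  have pw: "q' ^ i \<noteq> q' ^ j" if "i < j" for i j
  proof
    assume "q' ^ i = q' ^ j"
    then have "q' ^ (j - i) = 1" using q(1) that by (intro power_diff_eq_1) auto
    then show False using q(2) that by auto
  qed
  define Q where "Q = q' ^ (2 * N + 1)"
  have Q: "Q \<noteq> 0" "a' = Q \<or> a' = 1 / Q" using a q by (simp_all add: Q_def)
  have "spec (summand q a b c k) (summand q' a' b' c' k)" if "k \<le> M" for k
  proof (rule spec_summand [OF sp nz])
    \<comment> \<open>The exponents \<open>2 * N + 2 + j\<close> and
      \<open>j + 1 - (2 * N + 1)\<close> are nonzero, the latter because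
      \<open>j < k \<le> M \<le> 2 * N\<close>.\<close>
    have "q' * Q * q' ^ j \<noteq> 1" "q' * q' ^ j / Q \<noteq> 1" "q' * q' ^ j \<noteq> 1 / Q" if "j < k" for j
    proof -
      have "q' * Q * q' ^ j = q' ^ (Suc (2 * N + 1) + j)" unfolding Q_def power_add by simp
      then show 1: "q' * Q * q' ^ j \<noteq> 1" using q(2) [of "Suc (2 * N + 1) + j"] by (metis add_gr_0 zero_less_Suc)
      have "q' ^ Suc j \<noteq> Q" unfolding Q_def
        by (rule pw) (use that \<open>k \<le> M\<close> M in auto)
      then show "q' * q' ^ j / Q \<noteq> 1" using Q by simp
      show "q' * q' ^ j \<noteq> 1 / Q" using 1 Q by (auto simp: eq_divide_eq mult_ac)
    qed
    then show "qpochs [a' * q', q' / a'] q' k \<noteq> 0"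
      using Q by (auto simp: qpochs_def qpochhammer_eq_0_iff mult_ac)
    show "qpochhammer q' q' k \<noteq> 0" using q(2) by (auto simp: qpochhammer_eq_0_iff simp flip: power_Suc)
  qed (rule generic_denominators [OF gen])
  then have "spec ((\<Sum>k=0..M. summand q a b c k) - qrhs q b c N) ((\<Sum>k=0..M. summand q' a' b' c' k) - qrhs q' b' c' N)"
    by (intro spec_diff spec_sum spec_qrhs sp nz generic_denominators [OF gen]) auto
  moreover have "(\<Sum>k=0..M. summand q' a' b' c' k) = qrhs q' b' c' N"
    using q(2) by (intro sum_summand_terminating q(1) a gen M)
  ultimately show ?thesis by simp
qed

text \<open>The order \<open>2 * L + 1\<close> may be a proper divisor of \<open>2 * N + 1\<close>,
  so the range of summation can cover several blocks. The right-hand side vanishes separately,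
  through its factor \<open>[2N + 1]\<close>.\<close>

lemma spec_root_of_unity:
  assumes sp: "spec q q'" "spec a a'" "spec b b'" "spec c c'"
    and q: "\<And>i. 0 < i \<Longrightarrow> q ^ i \<noteq> 1"
    and ord: "\<And>i. q' ^ i = 1 \<longleftrightarrow> (2 * L + 1) dvd i" and L: "L > 0" and two: "(2 :: 'k) \<noteq> 0"
    and gen: "generic_wrt q' a'" "generic_wrt q' b'" "generic_wrt q' c'" "generic_wrt q' (b' * c')"
    and dvd: "(2 * L + 1) dvd (2 * N + 1)" and M: "M = 2 * N \<or> M = N"
  shows "spec ((\<Sum>k=0..M. summand q a b c k) - qrhs q b c N) 0"
proof -
  have nz: "a' \<noteq> 0" "b' \<noteq> 0" "c' \<noteq> 0" using gen by (auto simp: generic_wrt_def)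
  have q1: "q' \<noteq> 1" using ord [of 1] L by simp
  define g where "g k = qpochhammer q (q ^ 2) k / qpochhammer q q k" for k
  have pq: "qpochhammer q q k \<noteq> 0" for k
    using q by (auto simp: qpochhammer_eq_0_iff simp flip: power_Suc)
  \<comment> \<open>A zero factor would give \<open>q' ^ Suc j = - 1\<close>, hence
    \<open>q' ^ (2 * Suc j) = 1\<close>. As the order is odd, \<open>q' ^ Suc j = 1\<close> follows,
    against \<open>2 \<noteq> 0\<close>.\<close>
  have mq: "qpochhammer (- q') q' k \<noteq> 0" for k
  proof
    assume "qpochhammer (- q') q' k = 0"
    then obtain j where j: "- (q' ^ Suc j) = 1" by (auto simp: qpochhammer_eq_0_iff)
    then have e: "q' ^ Suc j = - 1" by (metis minus_minus)
    then have "q' ^ (Suc j * 2) = 1" unfolding power_mult by simp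
    then have "(2 * L + 1) dvd Suc j * 2" using ord by blast
    moreover have "coprime (2 * L + 1) 2" by simp
    ultimately have "(2 * L + 1) dvd Suc j" using coprime_dvd_mult_left_iff by blast
    then have "q' ^ Suc j = 1" using ord by blast
    then show False using e two by (metis add.left_inverse one_add_one)
  qed
  have "\<exists>y. spec (g k) y" for k
  proof -
    have s: "spec (qpochhammer (- q) q k) (qpochhammer (- q') q' k)"
      by (intro spec_qpochhammer spec_arith sp)
    have "spec (g k) (gauss_binomial q' (2 * k) k / qpochhammer (- q') q' k)"
      unfolding g_def qpochhammer_ratio_gauss [OF pq spec_nonzero [OF s mq]]
      by (intro spec_divide spec_gauss_binomial s mq sp)
    then show ?thesis ..
  qed
  then obtain y where y: "\<And>k. spec (g k) (y k)" by metis
  have y0: "y 0 = 1" using spec_unique [OF y [of 0]] spec_1 by (simp add: g_def)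
  \<comment> \<open>The recurrence holds for the generic quotients \<open>g k\<close>, where one may
    divide, and is then specialised.\<close>
  have ySuc: "y (Suc k) * (1 - q' ^ (k + 1)) = y k * (1 - q' ^ (2 * k + 1))" for k
  proof (rule spec_unique)
    show "spec (g (Suc k) * (1 - q ^ (k + 1))) (y (Suc k) * (1 - q' ^ (k + 1)))"
      by (intro spec_arith y sp)
    have "q * q ^ k \<noteq> 1" using q [of "Suc k"] by simp
    then have "g (Suc k) * (1 - q ^ (k + 1)) = g k * (1 - q ^ (2 * k + 1))"
      by (simp add: g_def power_mult)
    then show "spec (g (Suc k) * (1 - q ^ (k + 1))) (y k * (1 - q' ^ (2 * k + 1)))"
      by (simp only:) (intro spec_arith y sp)
  qed
  have "spec (summand q a b c k) (qint q' (3 * k + 1) * (y k * wfac q' a' b' c' k) * q' ^ k)" for k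
  proof -
    have "qpochs [a' * q', q' / a'] q' k \<noteq> 0"
      using gen(1) by (auto simp: qpochs_def qpochhammer_eq_0_iff generic_wrt_def mult.assoc simp flip: power_Suc)
    then show ?thesis unfolding summand_wfac g_def [symmetric]
      by (intro spec_arith spec_qint spec_wfac y sp nz generic_denominators [OF gen(2-4)])
  qed
  then have "spec ((\<Sum>k=0..M. summand q a b c k) - qrhs q b c N)
      ((\<Sum>k=0..M. qint q' (3 * k + 1) * (y k * wfac q' a' b' c' k) * q' ^ k) - qrhs q' b' c' N)"
    by (intro spec_diff spec_sum spec_qrhs sp nz generic_denominators [OF gen(2-4)])
  moreover have "(\<Sum>k=0..M. qint q' (3 * k + 1) * (y k * wfac q' a' b' c' k) * q' ^ k) = 0"
    by (rule block_sum_root_of_unity [OF ord L gen y0 ySuc _ dvd]) (use M in auto)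
  moreover have "qrhs q' b' c' N = 0"
  proof -
    have "q' ^ (2 * N + 1) = 1" using ord dvd by blast
    then show ?thesis unfolding qrhs_def qint_field [OF q1] by simp
  qed
  ultimately show ?thesis by simp
qed

end

section \<open>Divisibility criteria\<close>

locale comm_ring_hom =
  fixes h :: "'r::comm_ring_1 \<Rightarrow> 's::comm_ring_1"
  assumes hom_0: "h 0 = 0" and hom_1: "h 1 = 1"
    and hom_add: "h (x + y) = h x + h y" and hom_mult: "h (x * y) = h x * h y"
begin

lemma hom_sum: "h (sum f S) = (\<Sum>i\<in>S. h (f i))"
  by (induction S rule: infinite_finite_induct) (simp_all add: hom_0 hom_add)

lemma comm_ring_hom_map_poly: "comm_ring_hom (map_poly h)"
proof
  show "map_poly h (p + p') = map_poly h p + map_poly h p'" for p p'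
    by (intro poly_eqI) (simp add: coeff_map_poly hom_0 hom_add)
  show "map_poly h (p * p') = map_poly h p * map_poly h p'" for p p'
    by (intro poly_eqI) (simp add: coeff_map_poly hom_0 coeff_mult hom_sum hom_mult)
qed (simp_all add: hom_1)

lemma comm_ring_hom_poly: "comm_ring_hom (\<lambda>p. poly (map_poly h p) x)"
proof -
  interpret m: comm_ring_hom "map_poly h" by (rule comm_ring_hom_map_poly)
  show ?thesis by unfold_locales (simp_all add: m.hom_add m.hom_mult hom_1)
qed

end

lemma qint_indet_degree:
  assumes "n > 0"
  shows "degree (qint [:0, 1 :: int:] n) = n - 1" "lead_coeff (qint [:0, 1 :: int:] n) = 1"
proof -
  have e: "qint [:0, 1 :: int:] n = (\<Sum>i<n. monom 1 i)"
    by (simp add: qint_def monom_altdef)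
  have c: "coeff (qint [:0, 1 :: int:] n) i = (if i < n then 1 else 0)" for i
    unfolding e by (simp add: coeff_sum)
  show d: "degree (qint [:0, 1 :: int:] n) = n - 1"
    using assms by (intro antisym degree_le le_degree) (auto simp: c)
  show "lead_coeff (qint [:0, 1 :: int:] n) = 1" using assms unfolding d c by simp
qed

lemma comm_ring_hom_of_int: "comm_ring_hom (of_int :: int \<Rightarrow> 'a::comm_ring_1)"
  by unfold_locales simp_all

text \<open>\<open>[n]\<close> is monic, so the remainder of the division is an integer polynomial.
  It has the \<open>n - 1\<close> nontrivial \<open>n\<close>-th roots of unity as zeros but degree
  below \<open>n - 1\<close>, hence is zero. No splitting into cyclotomic factors is
  required.\<close>

lemma qint_dvd_int_poly:
  fixes p :: "int poly"
  assumes n: "n > 0" and root: "\<And>z :: complex. z ^ n = 1 \<Longrightarrow> z \<noteq> 1 \<Longrightarrow> poly (map_poly of_int p) z = 0"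
  shows "qint [:0, 1:] n dvd p"
proof -
  define g where "g = qint [:0, 1 :: int:] n"
  note g = qint_indet_degree [OF n, folded g_def]
  have "g \<noteq> 0" using g(2) by auto
  obtain s r where sr: "pseudo_divmod p g = (s, r)" by fastforce
  have p: "p = g * s + r" and r: "r = 0 \<or> degree r < degree g"
    using pseudo_divmod [OF \<open>g \<noteq> 0\<close> sr] g(2) by simp_all
  interpret comm_ring_hom "map_poly of_int :: int poly \<Rightarrow> complex poly"
    by (rule comm_ring_hom.comm_ring_hom_map_poly [OF comm_ring_hom_of_int])
  have X: "map_poly of_int [:0, 1 :: int:] = [:0, 1 :: complex:]" by (simp add: map_poly_pCons)
  have gz: "poly (map_poly of_int g) z = qint z n" for z :: complex
  proof -
    have "map_poly of_int ([:0, 1 :: int:] ^ i) = [:0, 1 :: complex:] ^ i" for i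
      by (induction i) (simp_all only: power_0 power_Suc hom_1 hom_mult X)
    then show ?thesis by (simp add: g_def qint_def hom_sum poly_sum poly_power)
  qed
  have rz: "poly (map_poly of_int r) z = 0" if "z ^ n = 1" "z \<noteq> 1" for z :: complex
    using root [OF that] that unfolding p hom_add hom_mult by (simp add: gz qint_field)
  have "r = 0"
  proof (rule ccontr)
    assume r0: "r \<noteq> 0"
    define R where "R = (map_poly of_int r :: complex poly)"
    have cR: "coeff R i = of_int (coeff r i)" for i by (simp add: R_def coeff_map_poly)
    have "R \<noteq> 0" using r0 by (auto simp: poly_eq_iff cR)
    have fin: "finite {z :: complex. z ^ n = 1}" using n by (simp add: finite_roots_unity)
    have "n - 1 = card ({z :: complex. z ^ n = 1} - {1})"
      using card_roots_unity_eq [OF n] fin by simp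
    also have "\<dots> \<le> card {z. poly R z = 0}"
      using rz \<open>R \<noteq> 0\<close> by (intro card_mono poly_roots_finite) (auto simp: R_def)
    also have "\<dots> \<le> degree R" using \<open>R \<noteq> 0\<close> by (rule card_poly_roots_bound)
    also have "\<dots> \<le> degree r" by (rule degree_le) (simp add: cR coeff_eq_0)
    finally show False using r r0 g(1) by simp
  qed
  then show ?thesis using p by (simp add: g_def)
qed

text \<open>\<open>1 - w X\<close> is not monic, so a power \<open>w ^ m\<close> is needed to divide
  \<open>p\<close> with a constant remainder, which evaluation at \<open>1 / w\<close> shows to be
  zero. The power is removed again because \<open>w X\<close> is congruent to 1 modulo
  \<open>1 - w X\<close>.\<close>

lemma dvd_of_root_inverse:
  fixes w :: "'a::idom" and p :: "'a poly"
  assumes w: "w \<noteq> 0" and root: "poly (fract_poly p) (1 / to_fract w) = 0"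
  shows "[:1, - w:] dvd p"
proof -
  let ?L = "[:1, - w:]"
  have "\<exists>m g r. smult (w ^ m) p = ?L * g + [:r:]" for p :: "'a poly"
  proof (induction p)
    case 0
    show ?case by (intro exI [of _ 0]) simp
  next
    case (pCons a p)
    then obtain m g r where e: "smult (w ^ m) p = ?L * g + [:r:]" by blast
    have "smult (w ^ Suc m) (pCons a p) = [:w ^ Suc m * a:] + [:0, w:] * smult (w ^ m) p"
      by (simp add: mult_ac)
    also have "\<dots> = ?L * ([:0, w:] * g - [:r:]) + [:w ^ Suc m * a + r:]"
      unfolding e by (simp add: algebra_simps)
    finally show ?case by blast
  qed
  then obtain m g r where e: "smult (w ^ m) p = ?L * g + [:r:]" by blast
  have f: "smult (to_fract (w ^ m)) (fract_poly p) = fract_poly ?L * fract_poly g + fract_poly [:r:]"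
    by (simp only: e fract_poly_add fract_poly_mult flip: fract_poly_smult)
  then have "0 = poly (fract_poly ?L * fract_poly g + fract_poly [:r:]) (1 / to_fract w)"
    unfolding f [symmetric] using root by simp
  also have "\<dots> = to_fract r" using w by (simp add: map_poly_pCons)
  finally have "r = 0" by simp
  then have d: "?L dvd smult (w ^ m) p"
    unfolding e \<open>r = 0\<close> by (simp only: pCons_0_0 add_0_right dvd_triv_left)
  have "?L dvd 1 - [:0, w:] ^ m"
  proof -
    have "1 - [:0, w:] ^ m = (1 - [:0, w:]) * (\<Sum>i<m. [:0, w:] ^ i)" by (rule one_diff_power_eq)
    moreover have "1 - [:0, w:] = ?L" by (simp add: one_pCons)
    ultimately show ?thesis by (metis dvd_triv_left)
  qed
  then have "?L dvd (1 - [:0, w:] ^ m) * p" by (rule dvd_mult2)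
  moreover have "[:0, w:] ^ m * p = smult (w ^ m) p * [:0, 1:] ^ m"
  proof -
    have "[:0, w:] = smult w [:0, 1:]" by simp
    then show ?thesis by (metis mult.commute mult_smult_left mult_smult_right smult_power)
  qed
  ultimately have "?L dvd (1 - [:0, w:] ^ m) * p + [:0, w:] ^ m * p"
    using d by (metis dvd_add dvd_mult2)
  then show ?thesis by (simp add: algebra_simps)
qed

text \<open>A divisor of a nonzero constant is constant, and a constant divisor of \<open>p\<close>
  divides each of its coefficients. This serves as a coprimality test where Bezout identities yield
  only a nonzero constant.\<close>

lemma is_unit_if_dvd_const_and_unit_coeff:
  fixes d p :: "'a::idom_divide poly"
  assumes "d dvd [:c:]" "c \<noteq> 0" "d dvd p" "coeff p i dvd 1"
  shows "d dvd 1"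
proof -
  have "degree d \<le> degree [:c:]" using assms by (intro dvd_imp_degree_le) auto
  then obtain u where u: "d = [:u:]" by (auto elim: degree_eq_zeroE)
  then have "u dvd coeff p i" using assms(3) by (simp add: const_poly_dvd_iff)
  then have "u dvd 1" using assms(4) by (rule dvd_trans)
  then show ?thesis using u by (simp add: one_pCons)
qed

section \<open>The numerator of the difference\<close>

lemma to_fract_power: "to_fract (x ^ i) = to_fract x ^ i"
  by (induction i) simp_all

text \<open>A homomorphism \<open>h\<close> on \<open>\<int>[q][a]\<close> extends to a place of \<open>\<int>[q][a][b][c]\<close> that keeps \<open>b\<close> and \<open>c\<close> indeterminate.\<close>

definition bc_place :: "(int poly poly \<Rightarrow> 'd::idom) \<Rightarrow> zpoly \<Rightarrow> 'd poly poly fract" where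
  "bc_place h p = to_fract (map_poly (map_poly h) p)"

definition cst :: "'d::idom \<Rightarrow> 'd poly poly fract" where
  "cst u = to_fract [:[:u:]:]"

lemma cst_simps:
  fixes u v :: "'d::idom"
  shows "cst (u * v) = cst u * cst v" "cst (u ^ i) = cst u ^ i" "cst (1 :: 'd) = 1" "cst (0 :: 'd) = 0" "cst u = cst v \<longleftrightarrow> u = v"
proof -
  have m: "cst (u * v) = cst u * cst v" for u v :: 'd
    by (simp add: cst_def mult.commute flip: to_fract_mult)
  have 1: "cst (1 :: 'd) = 1" by (simp add: cst_def flip: one_pCons)
  show "cst (u * v) = cst u * cst v" "cst (1 :: 'd) = 1" by (fact m 1)+
  show "cst (u ^ i) = cst u ^ i" by (induction i) (simp_all add: 1 m)
qed (simp_all add: cst_def)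

lemma cst_divide: "cst (u / v) = cst u / cst (v :: 'd :: field)"
proof (cases "v = 0")
  case False
  then have "cst v \<noteq> 0" by (simp add: cst_def)
  then show ?thesis using False by (simp add: eq_divide_eq flip: cst_simps(1))
qed (simp add: cst_simps(4))

text \<open>A nonzero constant multiple of \<open>b\<close>, \<open>c\<close> or
  \<open>b * c\<close> is never a constant, whereas all powers of \<open>cst u\<close> are.\<close>

lemma generic_bc:
  fixes u :: "'d::idom"
  assumes u: "u \<noteq> 0"
  shows "generic_wrt (cst u) (to_fract [:[:0, 1:]:])" "generic_wrt (cst u) (to_fract [:0, 1:])"
    "generic_wrt (cst u) (to_fract [:[:0, 1:]:] * to_fract [:0, 1:])"
proof -
  have gen: "generic_wrt (cst u) (to_fract p)"
    if "\<And>v w. v \<noteq> 0 \<Longrightarrow> p * [:[:v:]:] \<noteq> [:[:w:]:]" for p :: "'d poly poly"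
  proof -
    have "to_fract p * cst u ^ i \<noteq> cst w" for i w
      using that [of "u ^ i" w] u unfolding cst_simps(2) [symmetric]
      by (simp add: cst_def flip: to_fract_mult)
    from this [of _ 1] this [of 0] show ?thesis
      unfolding generic_wrt_def cst_simps(2) [symmetric] cst_simps(3) [symmetric]
      by (metis cst_simps(4) mult_1_right cst_simps(2,3) power_0)
  qed
  show "generic_wrt (cst u) (to_fract [:[:0, 1:]:])" "generic_wrt (cst u) (to_fract [:0, 1:])"
    by (rule gen, simp)+
  have "generic_wrt (cst u) (to_fract ([:[:0, 1:]:] * [:0, 1:]))"
    by (rule gen) simp
  then show "generic_wrt (cst u) (to_fract [:[:0, 1:]:] * to_fract [:0, 1:])"
    by (simp only: to_fract_mult)
qed

lemma fract_place_bc_place: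
  assumes "comm_ring_hom h"
  shows "fract_place (bc_place h)"
proof -
  interpret comm_ring_hom "map_poly (map_poly h)"
    by (intro comm_ring_hom.comm_ring_hom_map_poly assms)
  show ?thesis by unfold_locales (simp_all add: bc_place_def hom_0 hom_1 hom_add hom_mult)
qed

lemma bc_place_indets:
  assumes "comm_ring_hom h"
  shows "bc_place h indet_q = cst (h [:[:0, 1:]:])" "bc_place h indet_a = cst (h [:0, 1:])"
    "bc_place h indet_b = to_fract [:[:0, 1:]:]" "bc_place h indet_c = to_fract [:0, 1:]"
proof -
  interpret comm_ring_hom h by fact
  show "bc_place h indet_q = cst (h [:[:0, 1:]:])" "bc_place h indet_a = cst (h [:0, 1:])"
    "bc_place h indet_b = to_fract [:[:0, 1:]:]" "bc_place h indet_c = to_fract [:0, 1:]"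
    by (simp_all add: bc_place_def cst_def indet_q_def indet_a_def indet_b_def indet_c_def
        map_poly_pCons hom_0 hom_1 flip: one_pCons)
qed

text \<open>Since \<open>b\<close> and \<open>c\<close> stay indeterminate, vanishing at the place
  is vanishing of every coefficient in \<open>b\<close> and \<open>c\<close>. This reduces
  divisibility in four variables to divisibility in \<open>q\<close> and \<open>a\<close>.\<close>

lemma bc_place_coeff:
  assumes "comm_ring_hom h" "bc_place h p = 0"
  shows "h (coeff (coeff p i) j) = 0"
proof -
  interpret comm_ring_hom h by fact
  have "map_poly (map_poly h) p = 0" using assms(2) by (simp add: bc_place_def)
  then have "coeff (coeff (map_poly (map_poly h) p) i) j = 0" by simp
  then show ?thesis by (simp add: coeff_map_poly hom_0)
qed

lemma degree_X_power: "degree ([:0, 1 :: 'a::idom:] ^ i) = i"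
  by (simp add: degree_power_eq)

lemma indet_q_power: "indet_q ^ i = [:[:[:[:0, 1:] ^ i:]:]:]"
  unfolding indet_q_def by (induction i) (simp_all add: one_pCons mult.commute)

lemma indet_power_ne_1:
  assumes "0 < i"
  shows "to_fract indet_q ^ i \<noteq> (1 :: zpoly fract)" and "[:0, 1 :: 'a::idom:] ^ i \<noteq> 1"
proof -
  show "[:0, 1 :: 'a::idom:] ^ i \<noteq> 1"
    using degree_X_power [of i, where 'a = 'a] assms by (metis degree_1 less_irrefl)
  have "indet_q ^ i \<noteq> 1" unfolding indet_q_power using degree_X_power [of i, where 'a = int] assms by (auto simp: one_pCons)
  then show "to_fract indet_q ^ i \<noteq> (1 :: zpoly fract)"
    by (metis to_fract_1 to_fract_eq_iff to_fract_power)
qed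

context
  fixes N M :: nat and x :: "zpoly fract"
  assumes M: "M = 2 * N \<or> M = N"
  defines "x \<equiv> (\<Sum>k=0..M. summand (to_fract indet_q) (to_fract indet_a) (to_fract indet_b) (to_fract indet_c) k)
    - qrhs (to_fract indet_q) (to_fract indet_b) (to_fract indet_c) N"
begin

text \<open>The place sends \<open>a\<close> to a power of \<open>q\<close> in the fraction field of
  the polynomials in \<open>q\<close>; \<open>q\<close> itself stays an indeterminate and so is not
  a root of unity.\<close>

lemma numerator_root_a:
  fixes \<alpha> :: "int poly fract"
  defines "u \<equiv> to_fract [:0, 1 :: int:]"
  assumes \<alpha>: "\<alpha> = u ^ (2 * N + 1) \<or> \<alpha> = 1 / u ^ (2 * N + 1)"
  shows "poly (fract_poly (coeff (coeff (fst (quot_of_fract x)) i) j)) \<alpha> = 0"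
proof -
  define h where "h p = poly (fract_poly p) \<alpha>" for p :: "int poly poly"
  have h: "comm_ring_hom h"
    unfolding h_def by (rule comm_ring_hom.comm_ring_hom_poly) (unfold_locales, simp_all)
  interpret fract_place "bc_place h" by (rule fract_place_bc_place [OF h])
  have u0: "u \<noteq> 0" by (simp add: u_def)
  have hq: "h [:[:0, 1:]:] = u" "h [:0, 1:] = \<alpha>" by (simp_all add: h_def u_def map_poly_pCons)
  have ui: "u ^ i \<noteq> 1" if "0 < i" for i
  proof -
    have "u ^ i = to_fract ([:0, 1:] ^ i)" unfolding u_def by (rule to_fract_power [symmetric])
    then show ?thesis using indet_power_ne_1(2) [OF that, where 'a = int] by (metis to_fract_1 to_fract_eq_iff)
  qed
  have "spec x 0" unfolding x_def
  proof (rule spec_identity)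
    show "spec (to_fract indet_q) (cst u)" "spec (to_fract indet_a) (cst \<alpha>)"
      "spec (to_fract indet_b) (to_fract [:[:0, 1:]:])" "spec (to_fract indet_c) (to_fract [:0, 1:])"
      using spec_to_fract [of indet_q] spec_to_fract [of indet_a] spec_to_fract [of indet_b] spec_to_fract [of indet_c]
      unfolding bc_place_indets [OF h] hq by auto
    show "cst u \<noteq> 0" using u0 cst_simps(4,5) by metis
    show "cst u ^ i \<noteq> 1" if "0 < i" for i
      using ui [OF that] by (metis cst_simps(2,3,5))
    show "cst \<alpha> = cst u ^ (2 * N + 1) \<or> cst \<alpha> = 1 / cst u ^ (2 * N + 1)"
      using \<alpha> by (metis cst_simps(2,3) cst_divide)
  qed (rule generic_bc [OF u0] M)+
  then have "bc_place h (fst (quot_of_fract x)) = 0"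
    by (rule numerator_place_eq_0 [OF fract_place_axioms])
  from bc_place_coeff [OF h this] show ?thesis by (simp add: h_def)
qed

text \<open>The place sends \<open>q\<close> to \<open>z\<close> and keeps \<open>a\<close>,
  \<open>b\<close>, \<open>c\<close> indeterminate, so they are generic with respect to
  \<open>z\<close> and each coefficient can be read off.\<close>

lemma numerator_root_q:
  fixes z :: complex
  assumes z: "z ^ (2 * N + 1) = 1" "z \<noteq> 1"
  shows "poly (map_poly of_int (coeff (coeff (coeff (fst (quot_of_fract x)) i) j) l)) z = 0"
proof -
  define e where "e p = poly (map_poly of_int p) z" for p :: "int poly"
  have e: "comm_ring_hom e"
    unfolding e_def by (rule comm_ring_hom.comm_ring_hom_poly [OF comm_ring_hom_of_int])
  define h where "h = map_poly e"
  have h: "comm_ring_hom h" unfolding h_def by (rule comm_ring_hom.comm_ring_hom_map_poly [OF e])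
  interpret e: comm_ring_hom e by (rule e)
  interpret fract_place "bc_place h" by (rule fract_place_bc_place [OF h])
  have z0: "z \<noteq> 0" using z by auto
  have ez: "e [:0, 1:] = z" by (simp add: e_def map_poly_pCons)
  have hq: "h [:[:0, 1:]:] = [:z:]" "h [:0, 1:] = [:0, 1:]"
    by (simp_all add: h_def map_poly_pCons e.hom_0 e.hom_1 ez)
  \<comment> \<open>The order of \<open>z\<close>. It divides \<open>2 * N + 1\<close>, so it is
    odd, and it exceeds 1 because \<open>z \<noteq> 1\<close>.\<close>
  define d where "d = (LEAST i. 0 < i \<and> z ^ i = 1)"
  have d: "0 < d" "z ^ d = 1"
    using LeastI [of "\<lambda>i. 0 < i \<and> z ^ i = 1" "2 * N + 1"] z by (auto simp: d_def)
  have ord: "z ^ i = 1 \<longleftrightarrow> d dvd i" for i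
  proof
    assume "d dvd i"
    then show "z ^ i = 1" using d(2) by (auto simp: power_mult)
  next
    assume i: "z ^ i = 1"
    have "z ^ (i div d * d + i mod d) = z ^ (i mod d)"
      unfolding power_add using d(2) by (simp add: power_mult mult.commute [of _ d])
    then have "z ^ (i mod d) = 1" using i by simp
    moreover have "i mod d < d" using d(1) by simp
    ultimately have "\<not> 0 < i mod d" using not_less_Least [of "i mod d" "\<lambda>i. 0 < i \<and> z ^ i = 1"] by (auto simp: d_def)
    then show "d dvd i" by auto
  qed
  have dn: "d dvd 2 * N + 1" using ord z(1) by blast
  then have "odd d" using dvd_trans [of 2 d "2 * N + 1"] by auto
  then obtain L where L: "d = 2 * L + 1" by (auto elim: oddE)
  have L0: "L > 0" using L d(2) z(2) by (cases L) auto
  have u0: "[:z:] \<noteq> 0" using z0 by simp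
  have "spec x 0" unfolding x_def
  proof (rule spec_root_of_unity)
    show "spec (to_fract indet_q) (cst [:z:])" "spec (to_fract indet_a) (cst [:0, 1:])"
      "spec (to_fract indet_b) (to_fract [:[:0, 1:]:])" "spec (to_fract indet_c) (to_fract [:0, 1:])"
      using spec_to_fract [of indet_q] spec_to_fract [of indet_a] spec_to_fract [of indet_b] spec_to_fract [of indet_c]
      unfolding bc_place_indets [OF h] hq by auto
    show "to_fract indet_q ^ i \<noteq> (1 :: zpoly fract)" if "0 < i" for i
      by (rule indet_power_ne_1(1) [OF that])
    have zp: "[:z:] ^ i = [:z ^ i:]" for i by (induction i) (simp_all add: one_pCons mult.commute)
    show "cst [:z:] ^ i = 1 \<longleftrightarrow> (2 * L + 1) dvd i" for i
      using ord [of i] unfolding cst_simps(2) [symmetric] zp L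
      by (metis cst_simps(3,5) one_pCons pCons_eq_iff)
    show "(2 :: complex poly poly poly fract) \<noteq> 0"
      by (metis to_fract_1 to_fract_add one_add_one to_fract_eq_0_iff zero_neq_numeral)
    have g: "[:0, 1:] * [:z:] ^ i \<noteq> 1" "[:z:] ^ i \<noteq> [:0, 1:]" for i
      unfolding zp by (simp_all add: one_pCons)
    show "generic_wrt (cst [:z:]) (cst [:0, 1:])"
      using g unfolding generic_wrt_def cst_simps(1,2) [symmetric]
      by (metis cst_simps(3,4,5) one_neq_zero pCons_eq_0_iff)
    show "2 * L + 1 dvd 2 * N + 1" using dn L by simp
  qed (rule generic_bc [OF u0] M L0)+
  then have "bc_place h (fst (quot_of_fract x)) = 0"
    by (rule numerator_place_eq_0 [OF fract_place_axioms])
  from bc_place_coeff [OF h this] have "h (coeff (coeff (fst (quot_of_fract x)) i) j) = 0" .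
  then have "coeff (h (coeff (coeff (fst (quot_of_fract x)) i) j)) l = 0" by simp
  then show ?thesis by (simp add: h_def coeff_map_poly e.hom_0 e_def)
qed

end

lemma qint_indet_q: "qint indet_q n = [:[:[:qint [:0, 1:] n:]:]:]"
  unfolding qint_def indet_q_power by (induction n) simp_all

lemma poly_fract_poly_to_fract: "poly (fract_poly p) (to_fract w) = to_fract (poly p w)"
  by (induction p) (simp_all add: map_poly_pCons)

theorem theorem6p1:
  fixes n M :: nat and q a b c :: "zpoly fract"
  defines "q \<equiv> to_fract indet_q" and "a \<equiv> to_fract indet_a"
    and "b \<equiv> to_fract indet_b" and "c \<equiv> to_fract indet_c"
  assumes "n > 0" and "odd n"
    and "M = n - 1 \<or> M = (n - 1) div 2"
  shows "fract_cong
    (\<Sum>k=0..M. qint q (3 * k + 1)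
       * (qpochs [a * q, q / a, q] (q ^ 2) k * qpochs [q / b, q / c, b * c] q k)
       / (qpochs [a * q, q / a, q] q k
          * qpochs [b * q ^ 2, c * q ^ 2, q ^ 3 / (b * c)] (q ^ 2) k)
       * q ^ k)
    (qpochs [b * c * q, q ^ 2 / b, q ^ 2 / c] (q ^ 2) ((n - 1) div 2)
       / qpochs [q ^ 3 / (b * c), b * q ^ 2, c * q ^ 2] (q ^ 2) ((n - 1) div 2)
       * qint q n)
    (qint indet_q n * (1 - indet_a * indet_q ^ n) * (indet_a - indet_q ^ n))"
proof -
  obtain N where n: "n = 2 * N + 1" using assms(6) by (auto elim: oddE)
  have M: "M = 2 * N \<or> M = N" using assms(7) n by auto
  define x where "x = (\<Sum>k=0..M. summand q a b c k) - qrhs q b c N"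
  define r where "r = fst (quot_of_fract x)"
  define g where "g = qint [:0, 1 :: int:] n"
  define w where "w = [:0, 1 :: int:] ^ n"
  \<comment> \<open>The modulus as a polynomial in \<open>a\<close> over the polynomials in
    \<open>q\<close>, with \<open>w\<close> for the \<open>n\<close>-th power of
    \<open>q\<close>.\<close>
  define P where "P = [:g:] * ([:1, - w:] * [:- w, 1:])"
  have wu: "to_fract w = to_fract [:0, 1:] ^ n"
    unfolding w_def by (rule to_fract_power)
  have "P dvd coeff (coeff r i) j" for i j
  proof -
    define p where "p = coeff (coeff r i) j"
    have 1: "[:g:] dvd p"
      unfolding const_poly_dvd_iff g_def p_def r_def x_def q_def a_def b_def c_def
      using qint_dvd_int_poly [OF assms(5)] numerator_root_q [OF M] n by blast
    note root = numerator_root_a [OF M, of _ i j, folded q_def a_def b_def c_def, folded x_def, folded r_def, folded p_def]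
    have 2: "[:1, - w:] dvd p"
      by (rule dvd_of_root_inverse, simp add: w_def) (simp only: wu, rule root, simp add: n)
    have "poly (fract_poly p) (to_fract w) = 0"
      by (simp only: wu, rule root, simp add: n)
    then have 3: "[:- w, 1:] dvd p"
      by (simp add: poly_fract_poly_to_fract poly_eq_0_iff_dvd)
    have "g \<noteq> 0" using qint_indet_degree(2) [OF assms(5)] by (auto simp: g_def)
    have w1: "1 - w * w \<noteq> 0"
    proof -
      have "w * w = [:0, 1:] ^ (n + n)" by (simp add: w_def power_add)
      then show ?thesis using indet_power_ne_1(2) [of "n + n", where 'a = int] assms(5) by simp
    qed
    \<comment> \<open>A common divisor divides \<open>(1 - w * a) + w * (a - w) = 1 - w * w\<close>,
      a nonzero constant in \<open>a\<close>, and it divides the monic polynomial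
      \<open>a - w\<close>.\<close>
    have "coprime [:1, - w:] [:- w, 1:]"
    proof (rule coprimeI)
      fix d assume d: "d dvd [:1, - w:]" "d dvd [:- w, 1:]"
      have "[:1, - w:] + [:w:] * [:- w, 1:] = [:1 - w * w:]" by simp
      then have "d dvd [:1 - w * w:]" using d by (metis dvd_add dvd_mult)
      then show "is_unit d"
        using w1 d(2) by (rule is_unit_if_dvd_const_and_unit_coeff [where i = 1]) simp
    qed
    then have 23: "[:1, - w:] * [:- w, 1:] dvd p" using 2 3 by (rule divides_mult [rotated 2])
    \<comment> \<open>\<open>[:g:]\<close> is constant in \<open>a\<close>, while
      \<open>1 - w * a\<close> has constant coefficient 1 and \<open>a - w\<close> has leading
      coefficient 1.\<close>
    have "coprime [:g:] [:1, - w:]"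
      by (rule coprimeI, rule is_unit_if_dvd_const_and_unit_coeff [where i = 0 and c = g and p = "[:1, - w:]"])
        (use \<open>g \<noteq> 0\<close> in simp_all)
    moreover have "coprime [:g:] [:- w, 1:]"
      by (rule coprimeI, rule is_unit_if_dvd_const_and_unit_coeff [where i = 1 and c = g and p = "[:- w, 1:]"])
        (use \<open>g \<noteq> 0\<close> in simp_all)
    ultimately have "coprime [:g:] ([:1, - w:] * [:- w, 1:])"
      by (simp only: coprime_mult_right_iff)
    with 1 23 show ?thesis unfolding P_def p_def by (rule divides_mult)
  qed
  \<comment> \<open>\<open>P\<close> contains neither \<open>b\<close> nor \<open>c\<close>, so
    divisibility may be tested on the coefficients in \<open>b\<close> and \<open>c\<close>.\<close>
  then have "[:[:P:]:] dvd r" by (simp add: const_poly_dvd_iff)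
  moreover have "[:[:P:]:] = qint indet_q n * (1 - indet_a * indet_q ^ n) * (indet_a - indet_q ^ n)"
    unfolding qint_indet_q indet_q_power P_def g_def w_def indet_a_def
    by (simp add: one_pCons algebra_simps)
  ultimately show ?thesis
    unfolding fract_cong_def r_def x_def summand_def qrhs_def n by simp
qed

end
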